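(* Let $F$ be a number field, $v$ an archimedean place of $F$, $\overline{F}_v$ identified with $\mathbb{C}$, and suppose $E_v\subset\mathbb{C}$ is the intersection of two closed disks, one of which is centered at the origin. Then there is a non-zero complex number $\xi$ such that $E_v=\xi\cdot V$ with $V=D(0,r)\cap D(1,s)$ for some $r,s\ge0$, where $D(c,\rho)$ denotes the closed disk of center $c$ and radius $\rho$. One has $\gamma_v(E_v)=(|\xi|\cdot\gamma_\infty(V))^{[F_v:\mathbb{R}]}$, where $\gamma_\infty(V)$ is the classical transfinite diameter of $V$, which is computed as follows. If $V=\emptyset$ or $r+s=1$ then $\gamma_\infty(V)=0$. If $r\ge 1+s$ then $V=D(1,s)$ and $\gamma_\infty(V)=s$. If $s\ge 1+r$ then $V=D(0,r)$ and $\gamma_\infty(V)=r$. Otherwise the boundaries of $D(0,r)$ and $D(1,s)$ intersect in two points $u$ and $\overline{u}$ with $u$ in the upper half plane; let $\alpha\in(0,\pi)$ be the angle between the boundary of $D(0,r)$ and the boundary of $D(1,s)$ at the intersection point $u$. There is a unique point $\zeta$ in the upper half plane such that $$\zeta=\left(\frac{\overline{u}-r}{u-r}\right)^{\pi/(2\pi-\alpha)},$$ where the complex power is computed using the branch of $\log$ with imaginary part in $[0,2\pi]$, and $$\gamma_\infty(V)=\frac{1}{2\,\mathrm{Im}(\zeta)}\cdot\frac{\pi}{2\pi-\alpha}\cdot|\overline{u}-u|.$$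
   Context: $\gamma_v(E_v)$ denotes the local capacity (transfinite diameter relative to $\infty$) of $E_v$ at the archimedean place $v$, normalized as the classical transfinite diameter raised to the power $[F_v:\mathbb{R}]$. *)

theory Defs
  imports "HOL-Analysis.Analysis"
begin

section \<open>Number fields and archimedean places\<close>

definition number_field :: "'k::field_char_0 itself \<Rightarrow> bool" where
  "number_field _ \<longleftrightarrow>
     (\<exists>B :: 'k set. finite B \<and> module.span (\<lambda>q x. of_rat q * x) B = UNIV)"

definition absolute_value :: "('k::field \<Rightarrow> real) \<Rightarrow> bool" where
  "absolute_value w \<longleftrightarrow>
     (\<forall>x. 0 \<le> w x) \<and> (\<forall>x. w x = 0 \<longleftrightarrow> x = 0) \<and>
     (\<forall>x y. w (x * y) = w x * w y) \<and> (\<forall>x y. w (x + y) \<le> w x + w y)"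

definition equivalent_abs :: "('k::field \<Rightarrow> real) \<Rightarrow> ('k \<Rightarrow> real) \<Rightarrow> bool" where
  "equivalent_abs w w' \<longleftrightarrow> (\<exists>t>0. \<forall>x. w' x = w x powr t)"

definition archimedean :: "('k::field \<Rightarrow> real) \<Rightarrow> bool" where
  "archimedean w \<longleftrightarrow> \<not> (\<forall>x y. w (x + y) \<le> max (w x) (w y))"

text \<open>A place is a full equivalence class of absolute values.\<close>

definition archimedean_place :: "('k::field \<Rightarrow> real) set \<Rightarrow> bool" where
  "archimedean_place v \<longleftrightarrow>
     (\<exists>w. absolute_value w \<and> archimedean w \<and>
          v = {w'. absolute_value w' \<and> equivalent_abs w w'})"

definition field_embedding :: "('k::field \<Rightarrow> complex) \<Rightarrow> bool" where
  "field_embedding \<sigma> \<longleftrightarrow>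
     \<sigma> 1 = 1 \<and> (\<forall>x y. \<sigma> (x + y) = \<sigma> x + \<sigma> y) \<and> (\<forall>x y. \<sigma> (x * y) = \<sigma> x * \<sigma> y)"

text \<open>
  An identification of the algebraic closure of the completion \<open>F\<^sub>v\<close> with the complex numbers
  is recorded by the embedding \<open>\<sigma>\<close> of \<open>F\<close> that it induces; the usual modulus pulls back along
  \<open>\<sigma>\<close> to an absolute value belonging to \<open>v\<close>.
\<close>

definition identifies_with_complex :: "('k::field \<Rightarrow> real) set \<Rightarrow> ('k \<Rightarrow> complex) \<Rightarrow> bool" where
  "identifies_with_complex v \<sigma> \<longleftrightarrow> field_embedding \<sigma> \<and> (\<lambda>x. cmod (\<sigma> x)) \<in> v"

text \<open>
  Since the complex numbers are complete, \<open>F\<^sub>v\<close> becomes the closure of the image of \<open>F\<close>.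
\<close>

definition completion :: "('k::field \<Rightarrow> complex) \<Rightarrow> complex set" where
  "completion \<sigma> = closure (range \<sigma>)"

definition local_degree :: "('k::field \<Rightarrow> complex) \<Rightarrow> nat" where
  "local_degree \<sigma> = dim (completion \<sigma>)"

section \<open>Transfinite diameter and local capacity\<close>

definition nth_diameter :: "nat \<Rightarrow> complex set \<Rightarrow> real" where
  "nth_diameter n E =
     (SUP z \<in> {..<n} \<rightarrow> E. (\<Prod>j<n. \<Prod>i<j. cmod (z i - z j)) powr (1 / real (n choose 2)))"

text \<open>
  The empty set needs its own clause, because the supremum of the empty set of reals
  is unspecified.
\<close>

definition transfinite_diameter :: "complex set \<Rightarrow> real" where
  "transfinite_diameter E = (if E = {} then 0 else lim (\<lambda>n. nth_diameter n E))"

definition local_capacity :: "('k::field \<Rightarrow> complex) \<Rightarrow> complex set \<Rightarrow> real" where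
  "local_capacity \<sigma> E = transfinite_diameter E ^ local_degree \<sigma>"

section \<open>Angles and complex powers\<close>

definition vector_angle :: "complex \<Rightarrow> complex \<Rightarrow> real" where
  "vector_angle a b = arccos (inner a b / (norm a * norm b))"

text \<open>
  The unit tangent direction at \<open>u\<close> of an arc \<open>A\<close> with endpoint \<open>u\<close>, pointing into the arc.
\<close>

definition half_tangent :: "complex set \<Rightarrow> complex \<Rightarrow> complex" where
  "half_tangent A u = Lim (at u within A) (\<lambda>z. sgn (z - u))"

text \<open>
  Two crossing circles determine an angle only up to its supplement. The one meant here is the
  interior angle of \<open>A \<inter> B\<close> at the corner \<open>u\<close>, i.e. the angle between the two arcs that
  make up the boundary of \<open>A \<inter> B\<close>.
\<close>

definition boundary_angle :: "complex set \<Rightarrow> complex set \<Rightarrow> complex \<Rightarrow> real" where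
  "boundary_angle A B u =
     vector_angle (half_tangent (frontier A \<inter> B) u) (half_tangent (A \<inter> frontier B) u)"

text \<open>
  Values of \<open>w\<close> to the real power \<open>p\<close>, for logarithms with imaginary part in \<open>[0,2\<pi>]\<close>. This is
  a relation because on the positive reals both endpoints of that interval occur.
\<close>

definition branch_power :: "complex \<Rightarrow> real \<Rightarrow> complex \<Rightarrow> bool" where
  "branch_power w p \<zeta> \<longleftrightarrow>
     (\<exists>L. exp L = w \<and> 0 \<le> Im L \<and> Im L \<le> 2 * pi \<and> \<zeta> = exp (of_real p * L))"

end

theory Submission
  imports Defs "HOL-Complex_Analysis.Complex_Analysis" "HOL-Real_Asymp.Real_Asymp"
begin

text \<open>
  Suppose that \<open>x \<mapsto> \<psi> x / x\<close> maps the open unit disk, with \<open>0\<close> going to \<open>\<infinity>\<close>, into the complement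
  of a compact set \<open>E\<close> and the unit circle into \<open>E\<close>. Then \<open>E\<close> has transfinite diameter
  \<open>cmod (\<psi> 0)\<close>: by the maximum principle a monic polynomial of degree \<open>n\<close> attains on \<open>E\<close> a modulus
  of at least \<open>cmod (\<psi> 0) ^ n\<close>, so good points can be chosen greedily; conversely, monic polynomials
  with zeros on the images of circles are almost that small on \<open>E\<close>, and Lagrange interpolation turns
  this into an upper bound for the product of the mutual distances of any points of \<open>E\<close>.
  A disk has \<open>\<psi> x = s + c * x\<close>. For a lens with corners \<open>u\<close> and \<open>cnj u\<close>, the Moebius map
  \<open>(z - cnj u) / (z - u)\<close> turns the complement into a sector, which a power maps to a half-plane.
\<close>

section \<open>Transfinite diameter and exterior maps\<close>

text \<open>The constant has one factor for each map in the chain from the complement through the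
  sector and the half-plane to the disk. Near \<infinity> the Moebius map is
  \<open>1 + (u - cnj u) / z + ...\<close>; the power has derivative
  \<open>pi / (2 * pi - \<alpha>)\<close> at \<open>1\<close>; the half-plane has conformal radius
  \<open>2 * Im \<zeta>\<close> at \<open>1\<close>. Indeed \<open>r\<close> lies on the boundary of
  the lens, \<open>(cnj u - r) / (u - r)\<close> is its Moebius image, and \<zeta>, the
  corresponding root, is a unit vector along the line bounding the half-plane, so that
  \<open>Im \<zeta>\<close> is the distance of \<open>1\<close> from that line. The obstacle is that
  the sector opens by more than \<open>pi\<close>: arguments have to be tracked exactly, and they
  must stay inside \<open>(- pi, pi)\<close>.\<close>

lemma sum_lagrange_monic:
  fixes q :: "'a::field poly"
  assumes S: "finite S" "card S = Suc (degree q)" and q: "lead_coeff q = 1"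
  shows "(\<Sum>x\<in>S. poly q x / (\<Prod>y\<in>S - {x}. x - y)) = 1"
proof -
  define P where "P x = (\<Prod>y\<in>S - {x}. [:- y, 1:])" for x
  define L where "L = (\<Sum>x\<in>S. smult (poly q x / (\<Prod>y\<in>S - {x}. x - y)) (P x))"
  have deg: "degree (P x) = degree q" and lead: "coeff (P x) (degree q) = 1" if "x \<in> S" for x
  proof -
    show d: "degree (P x) = degree q"
      unfolding P_def using S that by (subst degree_prod_eq_sum_degree) auto
    have "lead_coeff (P x) = 1"
      unfolding P_def by (simp add: lead_coeff_prod)
    then show "coeff (P x) (degree q) = 1" by (simp add: d)
  qed
  have "poly L x = poly q x" if x: "x \<in> S" for x
  proof -
    have "poly (P x') x = (if x' = x then \<Prod>y\<in>S - {x}. x - y else 0)" if "x' \<in> S" for x'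
      using x that S(1) unfolding P_def by (auto simp: poly_prod intro!: prod_zero)
    then have "poly L x = (\<Sum>x'\<in>S. if x' = x then poly q x else 0)"
      unfolding L_def poly_sum by (intro sum.cong) (auto simp: S(1))
    then show ?thesis using S(1) x by simp
  qed
  moreover have "degree L \<le> degree q"
    unfolding L_def by (intro degree_sum_le S order_trans[OF degree_smult_le]) (simp add: deg)
  \<comment> \<open>Every \<open>P x\<close> is monic of degree \<open>degree q\<close>, so the sum
    in question is the coefficient of \<open>L\<close> in that degree.\<close>
  ultimately have "L = q"
    using S by (intro poly_eqI_degree[where A = S]) auto
  then have "coeff L (degree q) = 1" using q by simp
  then show ?thesis unfolding L_def by (simp add: coeff_sum lead)
qed

text \<open>Every unordered pair is counted twice; this avoids any ordering of the points, so that
  an induction may delete whichever point it likes.\<close>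

definition pair_prod :: "complex set \<Rightarrow> real" where
  "pair_prod S = (\<Prod>x\<in>S. \<Prod>y\<in>S - {x}. cmod (x - y))"

lemma pair_prod_insert:
  assumes "finite S" "x \<notin> S"
  shows "pair_prod (insert x S) = pair_prod S * (\<Prod>y\<in>S. cmod (x - y))\<^sup>2"
proof -
  have "pair_prod (insert x S) = (\<Prod>y\<in>S. cmod (x - y)) * (\<Prod>y\<in>S. \<Prod>z\<in>insert x S - {y}. cmod (y - z))"
    unfolding pair_prod_def using assms by simp
  also have "(\<Prod>y\<in>S. \<Prod>z\<in>insert x S - {y}. cmod (y - z))
      = (\<Prod>y\<in>S. cmod (x - y) * (\<Prod>z\<in>S - {y}. cmod (y - z)))"
  proof (rule prod.cong)
    fix y assume "y \<in> S"
    then have "insert x S - {y} = insert x (S - {y})" using assms by auto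
    then show "(\<Prod>z\<in>insert x S - {y}. cmod (y - z)) = cmod (x - y) * (\<Prod>z\<in>S - {y}. cmod (y - z))"
      using assms by (simp add: norm_minus_commute)
  qed simp
  finally show ?thesis
    by (simp add: pair_prod_def prod.distrib power2_eq_square)
qed

lemma pair_prod_image:
  fixes z :: "nat \<Rightarrow> complex"
  assumes "inj_on z {..<n}"
  shows "pair_prod (z ` {..<n}) = (\<Prod>j<n. \<Prod>i<j. cmod (z i - z j))\<^sup>2"
  using assms
proof (induction n)
  case 0
  then show ?case by (simp add: pair_prod_def)
next
  case (Suc n)
  have "inj_on z {..<n}" "z n \<notin> z ` {..<n}"
    using Suc.prems by (auto simp: lessThan_Suc)
  then show ?case
    using Suc.IH
    by (simp add: lessThan_Suc pair_prod_insert prod.reindex power_mult_distrib norm_minus_commute)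
qed

text \<open>By \<open>sum_lagrange_monic\<close> some \<open>x \<in> S\<close> satisfies \<open>(\<Prod>y\<in>S - {x}. cmod (x - y)) \<le> card S * M (card S - 1)\<close>;
  the induction removes this point.\<close>

lemma pair_prod_le:
  fixes M :: "nat \<Rightarrow> real"
  assumes M: "\<And>n. \<exists>q. lead_coeff q = 1 \<and> degree q = n \<and> (\<forall>z\<in>E. cmod (poly q z) \<le> M n)"
    and "finite S" "S \<subseteq> E"
  shows "pair_prod S \<le> (\<Prod>k<card S. real (Suc k) * M k)\<^sup>2"
  using assms(2,3)
proof (induction "card S" arbitrary: S)
  case 0
  then show ?case by (simp add: pair_prod_def)
next
  case (Suc n)
  obtain q where q: "lead_coeff q = 1" "degree q = n" "\<And>z. z \<in> E \<Longrightarrow> cmod (poly q z) \<le> M n"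
    using M by blast
  define w where "w x = (\<Prod>y\<in>S - {x}. cmod (x - y))" for x
  have w: "w x > 0" if "x \<in> S" for x
    unfolding w_def by (rule prod_pos) auto
  have "1 = cmod (\<Sum>x\<in>S. poly q x / (\<Prod>y\<in>S - {x}. x - y))"
    using sum_lagrange_monic[of S q] q Suc by simp
  also have "\<dots> \<le> (\<Sum>x\<in>S. M n / w x)"
    using q(3) w Suc.prems unfolding w_def
    by (intro order_trans[OF norm_sum] sum_mono)
       (auto simp: norm_divide prod_norm[symmetric] intro!: divide_right_mono prod_nonneg)
  finally have "1 \<le> (\<Sum>x\<in>S. M n / w x)" .
  then obtain x where x: "x \<in> S" "w x \<le> real (Suc n) * M n"
  proof (rule_tac ccontr)
    assume "1 \<le> (\<Sum>x\<in>S. M n / w x)" "\<not> thesis"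
    then have "real (Suc n) * M n < w x" if "x \<in> S" for x
      using that(1) \<open>\<And>x. _ \<Longrightarrow> _ \<Longrightarrow> thesis\<close> by force
    then have "M n / w x < 1 / real (Suc n)" if "x \<in> S" for x
      using w[OF that] that by (simp add: field_simps)
    then have "(\<Sum>x\<in>S. M n / w x) < (\<Sum>x\<in>S. 1 / real (Suc n))"
      using Suc by (intro sum_strict_mono) auto
    also have "\<dots> = 1" using Suc.hyps(2) by (simp del: of_nat_Suc)
    finally show False using \<open>1 \<le> _\<close> by simp
  qed
  have S: "S = insert x (S - {x})" "card (S - {x}) = n" using x Suc by auto
  have "pair_prod S = pair_prod (S - {x}) * (w x)\<^sup>2"
    using pair_prod_insert[of "S - {x}" x] Suc.prems S(1) by (simp add: w_def insert_absorb x)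
  also have "\<dots> \<le> (\<Prod>k<n. real (Suc k) * M k)\<^sup>2 * (real (Suc n) * M n)\<^sup>2"
    using Suc.hyps(1)[of "S - {x}"] Suc.prems S w[OF x(1)] x(2)
    by (intro mult_mono power_mono) auto
  finally show ?case
    by (simp add: Suc.hyps(2)[symmetric] power_mult_distrib)
qed

text \<open>On each subinterval the left endpoint value exceeds \<open>f\<close> by at most
  \<open>e\<close>. As \<open>f\<close> enters the bound only through \<open>e\<close> and its
  integral, one \<open>n\<close> serves a whole equicontinuous family.\<close>

lemma riemann_sum_le_integral:
  fixes f :: "real \<Rightarrow> real"
  assumes f: "continuous_on {0..1} f" and n: "n > 0"
    and e: "\<And>s t. s \<in> {0..1} \<Longrightarrow> t \<in> {0..1} \<Longrightarrow> \<bar>s - t\<bar> \<le> 1 / real n \<Longrightarrow> f s \<le> f t + e"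
  shows "(\<Sum>k<n. f (real k / real n)) \<le> real n * (integral {0..1} f + e)"
proof -
  have "(\<Sum>k<m. f (real k / real n)) / real n \<le> integral {0..real m / real n} f + real m / real n * e"
    if "m \<le> n" for m
    using that
  proof (induction m)
    case (Suc m)
    let ?a = "real m / real n" and ?b = "real (Suc m) / real n"
    have ab: "0 \<le> ?a" "?a \<le> ?b" "?b \<le> 1" "?b - ?a = 1 / real n"
      using Suc.prems n by (auto simp: field_simps)
    have int: "f integrable_on {s..t}" if "0 \<le> s" "t \<le> 1" for s t
      using that by (intro integrable_continuous_real continuous_on_subset[OF f]) auto
    have "(f ?a - e) * (1 / real n) \<le> integral {?a..?b} f"
    proof -
      have "integral {?a..?b} (\<lambda>_. f ?a - e) \<le> integral {?a..?b} f"
      proof (rule integral_le)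
        fix t assume t: "t \<in> {?a..?b}"
        then have "\<bar>?a - t\<bar> \<le> 1 / real n" "?a \<in> {0..1}" "t \<in> {0..1}"
            using ab unfolding atLeastAtMost_iff by linarith+
        from e[OF this(2,3,1)] show "f ?a - e \<le> f t" by simp
      qed (use int ab in auto)
      then show ?thesis using ab by (simp add: mult.commute)
    qed
    moreover have "integral {0..?a} f + integral {?a..?b} f = integral {0..?b} f"
      using ab int by (intro Henstock_Kurzweil_Integration.integral_combine) auto
    moreover have "(\<Sum>k<Suc m. f (real k / real n)) / real n = (\<Sum>k<m. f (real k / real n)) / real n + f ?a / real n"
      by (simp add: add_divide_distrib)
    moreover have "?b * e = ?a * e + e / real n"
      by (simp add: add_divide_distrib distrib_right)
    moreover have "(f ?a - e) * (1 / real n) = f ?a / real n - e / real n"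
      by (simp add: diff_divide_distrib)
    ultimately show ?case using Suc by linarith
  qed simp
  from this[of n] show ?thesis using n by (simp add: field_simps)
qed

section \<open>Mean values of logarithms and monic polynomials that are small on
  \<open>E\<close>\<close>

lemma has_integral_cmul_cancel:
  fixes c :: complex
  assumes "((\<lambda>t. c * f t) has_integral c * I) S" "c \<noteq> 0"
  shows "(f has_integral I) S"
proof -
  have "((\<lambda>t. inverse c * (c * f t)) has_integral inverse c * (c * I)) S"
    by (rule has_integral_mult_right[OF assms(1)])
  then show ?thesis using assms(2) by (simp flip: mult.assoc)
qed

text \<open>A zero-free \<open>F\<close> on a disk is \<open>exp H\<close>, so
  \<open>ln (cmod F)\<close> is the real part of the holomorphic \<open>H\<close>, whose mean value
  property is Cauchy's formula. This is Jensen's formula without zeros.\<close>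

lemma mean_ln_norm:
  fixes F :: "complex \<Rightarrow> complex"
  assumes F: "F holomorphic_on ball 0 R" "\<And>x. x \<in> ball 0 R \<Longrightarrow> F x \<noteq> 0" and \<rho>: "0 < \<rho>" "\<rho> < R"
  shows "((\<lambda>t. ln (cmod (F (of_real \<rho> * exp (2 * of_real pi * \<i> * of_real t))))) has_integral
      ln (cmod (F 0))) {0..1}"
proof -
  obtain H where H: "H holomorphic_on ball 0 R" "\<And>x. x \<in> ball 0 R \<Longrightarrow> F x = exp (H x)"
    using contractible_imp_holomorphic_log[OF F(1) convex_imp_contractible[OF convex_ball] F(2)] by blast
  let ?x = "\<lambda>t. of_real \<rho> * exp (2 * of_real pi * \<i> * of_real t) :: complex"
  have "((\<lambda>x. H x / (x - 0)) has_contour_integral 2 * of_real pi * \<i> * H 0) (circlepath 0 \<rho>)"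
    using \<rho> by (intro Cauchy_integral_circlepath holomorphic_on_imp_continuous_on holomorphic_on_subset[OF H(1)]) auto
  then have "((\<lambda>t. H (?x t) / ?x t * (2 * pi * \<i> * ?x t)) has_integral 2 * of_real pi * \<i> * H 0) {0..1}"
    unfolding has_contour_integral_def using \<rho>
    by (elim has_integral_eq[rotated])
       (simp add: vector_derivative_circlepath01, simp add: circlepath)
  then have "((\<lambda>t. (2 * pi * \<i>) * H (?x t)) has_integral (2 * pi * \<i>) * H 0) {0..1}"
    using \<rho> by (simp add: mult_ac)
  then have "((\<lambda>t. H (?x t)) has_integral H 0) {0..1}"
    by (rule has_integral_cmul_cancel) simp
  then have "((\<lambda>t. Re (H (?x t))) has_integral Re (H 0)) {0..1}"
    by (rule has_integral_Re)
  moreover have "?x t \<in> ball 0 R" for t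
    using \<rho> by (simp add: norm_mult)
  moreover have "0 \<in> ball (0::complex) R" using \<rho> by simp
  ultimately show ?thesis by (simp add: H(2))
qed


text \<open>The polynomial of degree \<open>n\<close> has its zeros at the points \<open>\<psi> x / x\<close> for \<open>x\<close> running through the
  \<open>n\<close>-th roots of unity times a radius \<open>\<rho> < 1\<close>, so that \<open>ln (cmod (poly q z)) / n\<close> is a Riemann sum
  of \<open>ln (cmod (\<psi> x - z * x)) - ln \<rho>\<close>, whose mean over the circle does not depend on \<open>z\<close>.\<close>

lemma chebyshev_bound_eventually:
  assumes E: "compact E" "E \<noteq> {}"
    and \<psi>: "\<psi> holomorphic_on ball 0 1"
    and nz: "\<And>x z. cmod x < 1 \<Longrightarrow> z \<in> E \<Longrightarrow> \<psi> x \<noteq> z * x"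
    and C': "cmod (\<psi> 0) < C'"
  shows "\<exists>N. \<forall>n\<ge>N. \<exists>q. lead_coeff q = 1 \<and> degree q = n \<and> (\<forall>z\<in>E. cmod (poly q z) \<le> C' ^ n)"
proof -
  define C where "C = cmod (\<psi> 0)"
  have C: "0 < C" "C < C'"
    using nz[of 0] E(2) C' by (auto simp: C_def)
  \<comment> \<open>The error of the Riemann sum, at most \<open>- ln \<rho>\<close> on average, and
    the division by \<open>cmod (x t) = \<rho>\<close> each cost a factor \<open>1 / \<rho>\<close>
    per root; together they turn \<open>C\<close> into \<open>C'\<close>.\<close>
  define \<rho> where "\<rho> = sqrt (C / C')"
  have \<rho>: "0 < \<rho>" "\<rho> < 1" "C / \<rho>\<^sup>2 = C'"
    using C by (auto simp: \<rho>_def)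
  define x where "x t = of_real \<rho> * exp (2 * of_real pi * \<i> * of_real t)" for t :: real
  have norm_x: "cmod (x t) = \<rho>" for t
    using \<rho> by (simp add: x_def norm_mult)
  define G where "G z t = ln (cmod (\<psi> (x t) - z * x t))" for z t
  have nz': "\<psi> (x t) - z * x t \<noteq> 0" if "z \<in> E" for z t
    using nz[of "x t" z] that norm_x \<rho> by simp
  have cont: "continuous_on (E \<times> {0..1}) (\<lambda>(z, t). G z t)"
    unfolding G_def case_prod_unfold using nz' norm_x \<rho>
    by (intro continuous_intros continuous_on_compose2[OF holomorphic_on_imp_continuous_on[OF \<psi>]])
       (auto simp: x_def intro!: continuous_intros)
  have int: "(G z has_integral ln C) {0..1}" if "z \<in> E" for z
  proof -
    have "(\<lambda>x. \<psi> x - z * x) holomorphic_on ball 0 1"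
      by (intro holomorphic_intros \<psi>)
    from mean_ln_norm[OF this _ \<rho>(1,2)] nz that show ?thesis
      by (simp add: G_def[abs_def] x_def C_def)
  qed
  \<comment> \<open>Joint uniform continuity in \<open>(z, t)\<close> makes the mesh, and hence
    \<open>N\<close>, independent of \<open>z\<close>.\<close>
  have "uniformly_continuous_on (E \<times> {0..1}) (\<lambda>(z, t). G z t)"
    using E by (intro compact_uniformly_continuous cont compact_Times) auto
  moreover have "- ln \<rho> > 0" using \<rho> by simp
  ultimately obtain d where d: "d > 0"
    "\<And>p p'. p \<in> E \<times> {0..1} \<Longrightarrow> p' \<in> E \<times> {0..1} \<Longrightarrow> dist p' p < d \<Longrightarrow>
      dist (case p' of (z, t) \<Rightarrow> G z t) (case p of (z, t) \<Rightarrow> G z t) < - ln \<rho>"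
    unfolding uniformly_continuous_on_def by blast
  obtain N where N: "real N > 1 / d" using reals_Archimedean2 by blast
  show ?thesis
  proof (intro exI[of _ "Suc N"] allI impI)
    fix n assume n: "Suc N \<le> n"
    then have "real n > 1 / d" using N by linarith
    then have n': "0 < n" "1 / real n < d"
      using n d(1) by (auto simp: field_simps)
    define t where "t k = real k / real n" for k
    define q where "q = (\<Prod>k<n. [: - (\<psi> (x (t k)) / x (t k)), 1:])"
    have "lead_coeff q = 1"
      unfolding q_def lead_coeff_prod by simp
    moreover have "degree q = n"
      unfolding q_def by (simp add: degree_prod_eq_sum_degree)
    moreover have "cmod (poly q z) \<le> C' ^ n" if z: "z \<in> E" for z
    proof -
      have "(\<Sum>k<n. G z (t k)) \<le> real n * (integral {0..1} (G z) + - ln \<rho>)"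
        unfolding t_def
      proof (rule riemann_sum_le_integral)
        show "continuous_on {0..1} (G z)"
        proof -
          have "continuous_on {0..1} (\<lambda>t. (\<lambda>(z, t). G z t) (z, t))"
            by (rule continuous_on_compose2[OF cont]) (use z in \<open>auto intro!: continuous_intros\<close>)
          then show ?thesis by simp
        qed
        fix s t :: real assume st: "s \<in> {0..1}" "t \<in> {0..1}" "\<bar>s - t\<bar> \<le> 1 / real n"
        have "dist (z, s) (z, t) < d" using st n' by (simp add: dist_Pair_Pair dist_real_def)
        from d(2)[OF _ _ this] show "G z s \<le> G z t + - ln \<rho>"
          using z st by (auto simp: dist_real_def)
      qed (use n' in auto)
      also have "integral {0..1} (G z) = ln C" using int[OF z] by (rule integral_unique)
      finally have sum: "(\<Sum>k<n. G z (t k)) \<le> real n * (ln C - ln \<rho>)" by simp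
      have "cmod (poly q z) = (\<Prod>k<n. exp (G z (t k)) / \<rho>)"
        unfolding q_def poly_prod prod_norm[symmetric]
      proof (rule prod.cong)
        fix k
        have "x (t k) \<noteq> 0" using norm_x \<rho> by force
        then have "z - \<psi> (x (t k)) / x (t k) = - (\<psi> (x (t k)) - z * x (t k)) / x (t k)"
          by (simp add: field_simps)
        then have "cmod (z - \<psi> (x (t k)) / x (t k)) = cmod (\<psi> (x (t k)) - z * x (t k)) / \<rho>"
          by (simp only: norm_divide norm_minus_cancel norm_x)
        then show "cmod (poly [: - (\<psi> (x (t k)) / x (t k)), 1:] z) = exp (G z (t k)) / \<rho>"
          using nz'[OF z] by (simp add: G_def)
      qed simp
      also have "\<dots> = exp (\<Sum>k<n. G z (t k)) / \<rho> ^ n"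
        by (simp add: prod_dividef exp_sum)
      also have "\<dots> \<le> exp (real n * (ln C - ln \<rho>)) / \<rho> ^ n"
        using sum \<rho> by (intro divide_right_mono) auto
      also have "\<dots> = (exp (ln C - ln \<rho>) / \<rho>) ^ n"
        by (simp add: exp_of_nat_mult power_divide)
      also have "exp (ln C - ln \<rho>) / \<rho> = C'"
        using \<rho> C by (simp add: exp_diff power2_eq_square)
      finally show ?thesis .
    qed
    ultimately show "\<exists>q. lead_coeff q = 1 \<and> degree q = n \<and> (\<forall>z\<in>E. cmod (poly q z) \<le> C' ^ n)"
      by blast
  qed
qed

text \<open>The finitely many degrees below \<open>N\<close> are served by \<open>z ^ n\<close>,
  whose size on the bounded set \<open>E\<close> is absorbed into \<open>A\<close>. Small degrees
  matter because \<open>pair_prod_le\<close> multiplies the bounds over all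
  \<open>k < card S\<close>.\<close>

lemma chebyshev_bound:
  assumes E: "compact E" "E \<noteq> {}"
    and \<psi>: "\<psi> holomorphic_on ball 0 1"
    and nz: "\<And>x z. cmod x < 1 \<Longrightarrow> z \<in> E \<Longrightarrow> \<psi> x \<noteq> z * x"
    and C': "cmod (\<psi> 0) < C'"
  obtains A where "A \<ge> 1"
    "\<And>n. \<exists>q. lead_coeff q = 1 \<and> degree q = n \<and> (\<forall>z\<in>E. cmod (poly q z) \<le> A * C' ^ n)"
proof -
  have C: "0 < C'" using C' norm_ge_zero le_less_trans by blast
  obtain N where N: "\<And>n. n \<ge> N \<Longrightarrow>
      \<exists>q. lead_coeff q = 1 \<and> degree q = n \<and> (\<forall>z\<in>E. cmod (poly q z) \<le> C' ^ n)"
    using chebyshev_bound_eventually[OF assms] by blast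
  obtain B where B: "\<And>z. z \<in> E \<Longrightarrow> cmod z \<le> B" "B > 0"
    using compact_imp_bounded[OF E(1)] unfolding bounded_pos by auto
  define A where "A = 1 + (\<Sum>n<N. (B / C') ^ n)"
  have A: "A \<ge> 1" unfolding A_def using B C by (auto intro!: sum_nonneg)
  show thesis
  proof (rule that[OF A])
    fix n
    show "\<exists>q. lead_coeff q = 1 \<and> degree q = n \<and> (\<forall>z\<in>E. cmod (poly q z) \<le> A * C' ^ n)"
    proof (cases "n \<ge> N")
      case True
      moreover have "C' ^ n \<le> A * C' ^ n" using A C by simp
      ultimately show ?thesis using N by (meson order_trans)
    next
      case False
      have "(B / C') ^ n \<le> A"
        unfolding A_def using False B C
        by (intro order_trans[OF member_le_sum[of n "{..<N}" "\<lambda>n. (B / C') ^ n"]]) auto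
      then have "B ^ n \<le> A * C' ^ n" using C by (simp add: power_divide field_simps)
      moreover have "cmod (poly (monom 1 n) z) \<le> B ^ n" if "z \<in> E" for z
        using B(1)[OF that] by (simp add: poly_monom norm_power power_mono)
      ultimately show ?thesis
        by (intro exI[of _ "monom 1 n"]) (auto simp: degree_monom_eq intro: order_trans)
    qed
  qed
qed

text \<open>Bernstein--Walsh: apply the maximum principle to
  \<open>x ^ n * p (\<psi> x / x)\<close>, where \<open>p\<close> is the monic polynomial with roots \<open>y i\<close>.\<close>

lemma monic_max_ge:
  fixes \<psi> :: "complex \<Rightarrow> complex"
  assumes \<psi>: "\<psi> holomorphic_on ball 0 1" "continuous_on (cball 0 1) \<psi>"
    and bd: "\<And>x. cmod x = 1 \<Longrightarrow> \<psi> x / x \<in> E"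
  shows "\<exists>x\<in>E. cmod (\<psi> 0) ^ card I \<le> (\<Prod>i\<in>I. cmod (x - y i))"
proof (rule ccontr)
  assume contr: "\<not> ?thesis"
  define f where "f x = (\<Prod>i\<in>I. \<psi> x - y i * x)" for x
  have f_bd: "cmod (f x) < cmod (\<psi> 0) ^ card I" if "cmod x = 1" for x
  proof -
    have "x \<noteq> 0" using that by auto
    then have "\<psi> x - y i * x = (\<psi> x / x - y i) * x" for i
      by (simp add: left_diff_distrib)
    then have "cmod (\<psi> x - y i * x) = cmod (\<psi> x / x - y i)" for i
      using that by (simp add: norm_mult)
    then have "cmod (f x) = (\<Prod>i\<in>I. cmod (\<psi> x / x - y i))"
      by (simp add: f_def prod_norm[symmetric])
    moreover have "\<not> cmod (\<psi> 0) ^ card I \<le> (\<Prod>i\<in>I. cmod (\<psi> x / x - y i))"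
      using contr bd[OF that] by blast
    ultimately show ?thesis by linarith
  qed
  have cont: "continuous_on (cball 0 1) f"
    unfolding f_def by (intro continuous_intros \<psi>)
  have "\<exists>x0\<in>sphere 0 1. \<forall>x\<in>sphere 0 1. cmod (f x) \<le> cmod (f x0)"
    by (intro continuous_attains_sup continuous_on_norm continuous_on_subset[OF cont]) auto
  then obtain x0 where x0: "x0 \<in> sphere 0 1" "\<And>x. x \<in> sphere 0 1 \<Longrightarrow> cmod (f x) \<le> cmod (f x0)"
    by blast
  have "cmod (f 0) \<le> cmod (f x0)"
  proof (rule maximum_modulus_frontier[where f = f and S = "cball 0 1"])
    show "f holomorphic_on interior (cball 0 1)"
      unfolding f_def interior_cball by (intro holomorphic_intros \<psi>)
    show "continuous_on (closure (cball 0 1)) f"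
      using cont by simp
    show "cmod (f z) \<le> cmod (f x0)" if "z \<in> frontier (cball 0 1)" for z
      using that x0(2) by simp
  qed auto
  then have "cmod (\<psi> 0) ^ card I \<le> cmod (f x0)" by (simp add: f_def norm_power)
  with f_bd[of x0] x0 show False by simp
qed

section \<open>Products of mutual distances and the limit of the diameters\<close>

lemma nth_diameter_upper_bound:
  fixes M :: "nat \<Rightarrow> real"
  assumes M: "\<And>n. \<exists>q. lead_coeff q = 1 \<and> degree q = n \<and> (\<forall>z\<in>E. cmod (poly q z) \<le> M n)"
    and M0: "\<And>n. 0 \<le> M n" and z: "z \<in> {..<n} \<rightarrow> E"
  shows "(\<Prod>j<n. \<Prod>i<j. cmod (z i - z j)) \<le> (\<Prod>k<n. real (Suc k) * M k)"
proof (cases "inj_on z {..<n}")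
  case True
  then have "(\<Prod>j<n. \<Prod>i<j. cmod (z i - z j))\<^sup>2 = pair_prod (z ` {..<n})"
    by (rule pair_prod_image[symmetric])
  also have "\<dots> \<le> (\<Prod>k<n. real (Suc k) * M k)\<^sup>2"
    using pair_prod_le[OF M, where S = "z ` {..<n}"] z True by (simp add: card_image image_subset_iff Pi_iff)
  finally show ?thesis
    using M0 by (elim power2_le_imp_le) (auto intro!: prod_nonneg)
next
  case False
  then obtain i j where ij: "i < n" "j < n" "i \<noteq> j" "z i = z j" by (auto simp: inj_on_def)
  then obtain i j where ij: "i < j" "j < n" "z i = z j" by (metis nat_neq_iff)
  then have "(\<Prod>i<j. cmod (z i - z j)) = 0" by (intro prod_zero) auto
  then have "(\<Prod>j<n. \<Prod>i<j. cmod (z i - z j)) = 0" using ij by (intro prod_zero) auto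
  moreover have "0 \<le> (\<Prod>k<n. real (Suc k) * M k)" using M0 by (intro prod_nonneg) auto
  ultimately show ?thesis by linarith
qed

lemma choose_2_simps: "0 choose 2 = (0 :: nat)" "Suc n choose 2 = (n choose 2) + n"
  by (simp_all add: numeral_2_eq_2)

lemma choose_2_real: "real (n choose 2) = real n * (real n - 1) / 2"
  by (induction n) (simp_all add: choose_2_simps field_simps)

text \<open>Each new point comes from \<open>monic_max_ge\<close> applied to the earlier ones, and
  the exponents \<open>0, ..., n - 1\<close> add up to \<open>n choose 2\<close>. The points
  resemble Leja points and need not maximize the product.\<close>

lemma fekete_points:
  fixes \<psi> :: "complex \<Rightarrow> complex"
  assumes "\<psi> holomorphic_on ball 0 1" "continuous_on (cball 0 1) \<psi>"
    and "\<And>x. cmod x = 1 \<Longrightarrow> \<psi> x / x \<in> E"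
  shows "\<exists>z \<in> {..<n} \<rightarrow> E. cmod (\<psi> 0) ^ (n choose 2) \<le> (\<Prod>j<n. \<Prod>i<j. cmod (z i - z j))"
proof (induction n)
  case (Suc n)
  then obtain z where z: "z \<in> {..<n} \<rightarrow> E"
    "cmod (\<psi> 0) ^ (n choose 2) \<le> (\<Prod>j<n. \<Prod>i<j. cmod (z i - z j))" by blast
  obtain x where x: "x \<in> E" "cmod (\<psi> 0) ^ n \<le> (\<Prod>i<n. cmod (x - z i))"
    using monic_max_ge[OF assms, of "{..<n}" z] by auto
  have "(\<Prod>j<Suc n. \<Prod>i<j. cmod ((z(n := x)) i - (z(n := x)) j))
      = (\<Prod>j<n. \<Prod>i<j. cmod (z i - z j)) * (\<Prod>i<n. cmod (x - z i))"
    by (simp add: norm_minus_commute)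
  moreover have "cmod (\<psi> 0) ^ (Suc n choose 2) \<le> \<dots>"
    unfolding choose_2_simps power_add using z x by (intro mult_mono) (auto intro!: prod_nonneg)
  moreover have "z(n := x) \<in> {..<Suc n} \<rightarrow> E"
    using z(1) x(1) by (auto simp: less_Suc_eq)
  ultimately show ?case by metis
qed (auto simp: choose_2_simps)

text \<open>Under the root of order \<open>n choose 2\<close> the factor \<open>(n * A) ^ n\<close>
  becomes \<open>(n * A) powr (2 / (n - 1))\<close>, which tends to \<open>1\<close>; a crude bound
  for the factorial is therefore enough.\<close>

lemma prod_fact_le:
  assumes "A \<ge> 0" "C \<ge> 0"
  shows "(\<Prod>k<n. real (Suc k) * (A * C ^ k)) \<le> (real n * A) ^ n * C ^ (n choose 2)"
proof -
  have "(\<Prod>k<n. real (Suc k) * (A * C ^ k)) = fact n * A ^ n * C ^ (n choose 2)"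
    by (induction n) (simp_all add: choose_2_simps power_add del: of_nat_Suc)
  also have "\<dots> \<le> (real n ^ n * A ^ n) * C ^ (n choose 2)"
    using assms fact_le_power[of n, where 'a = real] by (intro mult_right_mono) auto
  finally show ?thesis by (simp add: power_mult_distrib)
qed

lemma tendsto_nth_diameter:
  fixes \<psi> :: "complex \<Rightarrow> complex"
  assumes E: "compact E" "E \<noteq> {}"
    and \<psi>: "\<psi> holomorphic_on ball 0 1" "continuous_on (cball 0 1) \<psi>"
    and nz: "\<And>x z. cmod x < 1 \<Longrightarrow> z \<in> E \<Longrightarrow> \<psi> x \<noteq> z * x"
    and bd: "\<And>x. cmod x = 1 \<Longrightarrow> \<psi> x / x \<in> E"
  shows "(\<lambda>n. nth_diameter n E) \<longlonglongrightarrow> cmod (\<psi> 0)"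
proof -
  define C where "C = cmod (\<psi> 0)"
  have C: "0 < C" using nz[of 0] E(2) by (auto simp: C_def)
  define P where "P z n = (\<Prod>j<n. \<Prod>i<j. cmod (z i - z j))" for z :: "nat \<Rightarrow> complex" and n
  have P: "P z n \<ge> 0" for z n unfolding P_def by (intro prod_nonneg ballI) auto
  have *: "C \<le> nth_diameter n E \<and> nth_diameter n E \<le> (real n * A) powr (2 / (real n - 1)) * C'"
    if n: "n \<ge> 2" and A: "A \<ge> 1" and C': "C' > 0"
      and M: "\<And>n. \<exists>q. lead_coeff q = 1 \<and> degree q = n \<and> (\<forall>z\<in>E. cmod (poly q z) \<le> A * C' ^ n)"
    for A C' n
  proof -
    define N where "N = n choose 2"
    have N: "N > 0" unfolding N_def using n by simp
    have N2: "real n / real N = 2 / (real n - 1)"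
      using n by (simp add: N_def choose_2_real field_simps)
    have le: "P z n powr (1 / N) \<le> (real n * A) powr (2 / (real n - 1)) * C'"
      if z: "z \<in> {..<n} \<rightarrow> E" for z
    proof -
      have "P z n \<le> (\<Prod>k<n. real (Suc k) * (A * C' ^ k))"
        unfolding P_def using nth_diameter_upper_bound[OF M _ z] A C' by simp
      also have "\<dots> \<le> (real n * A) ^ n * C' ^ N"
        unfolding N_def using A C' by (intro prod_fact_le) auto
      finally have "P z n powr (1 / N) \<le> ((real n * A) ^ n * C' ^ N) powr (1 / N)"
        using P by (intro powr_mono2) auto
      also have "\<dots> = ((real n * A) powr real n) powr (1 / N) * (C' powr real N) powr (1 / N)"
        using n A C' by (subst powr_mult) (auto simp: powr_realpow)
      also have "\<dots> = (real n * A) powr (2 / (real n - 1)) * C'"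
        using N C' by (simp add: powr_powr N2)
      finally show ?thesis .
    qed
    obtain z where z: "z \<in> {..<n} \<rightarrow> E" "C ^ N \<le> P z n"
      using fekete_points[OF \<psi> bd, of n] unfolding C_def P_def N_def by blast
    have "C = (C powr N) powr (1 / N)" using C N by (simp add: powr_powr)
    also have "\<dots> \<le> P z n powr (1 / N)"
      using z C N by (intro powr_mono2) (auto simp: powr_realpow)
    finally have "C \<le> P z n powr (1 / N)" .
    moreover have "nth_diameter n E = (SUP z \<in> {..<n} \<rightarrow> E. P z n powr (1 / N))"
      by (simp add: nth_diameter_def P_def N_def)
    moreover have "bdd_above ((\<lambda>z. P z n powr (1 / N)) ` ({..<n} \<rightarrow> E))"
      using le by (auto simp: bdd_above_def)
    ultimately show ?thesis
      using le z(1) by (auto intro!: cSUP_least intro: cSUP_upper2)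
  qed
  have "(\<lambda>n. nth_diameter n E) \<longlonglongrightarrow> C"
  proof (rule order_tendstoI)
    fix a assume a: "a < C"
    \<comment> \<open>The lower estimate in \<open>*\<close> does not depend on \<open>A\<close> and
      \<open>C'\<close>; the value \<open>C + 1\<close> merely supplies an admissible pair.\<close>
    obtain A where A: "A \<ge> 1"
      "\<And>n. \<exists>q. lead_coeff q = 1 \<and> degree q = n \<and> (\<forall>z\<in>E. cmod (poly q z) \<le> A * (C + 1) ^ n)"
      using chebyshev_bound[OF E \<psi>(1) nz, of "C + 1"] unfolding C_def by auto
    show "\<forall>\<^sub>F n in sequentially. a < nth_diameter n E"
      using eventually_ge_at_top[of 2]
      by eventually_elim (use *[OF _ A(1) _ A(2)] C a in \<open>auto intro: less_le_trans\<close>)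
  next
    fix a assume a: "C < a"
    then obtain C' where C': "C < C'" "C' < a" using dense by blast
    obtain A where A: "A \<ge> 1"
      "\<And>n. \<exists>q. lead_coeff q = 1 \<and> degree q = n \<and> (\<forall>z\<in>E. cmod (poly q z) \<le> A * C' ^ n)"
      using chebyshev_bound[OF E \<psi>(1) nz, of C'] C' unfolding C_def by auto
    have "(\<lambda>n. (real n * A) powr (2 / (real n - 1))) \<longlonglongrightarrow> 1"
      using A(1) by real_asymp
    then have "(\<lambda>n. (real n * A) powr (2 / (real n - 1)) * C') \<longlonglongrightarrow> 1 * C'"
      by (intro tendsto_intros)
    then have "\<forall>\<^sub>F n in sequentially. (real n * A) powr (2 / (real n - 1)) * C' < a"
      using C'(2) by (intro order_tendstoD(2)[of _ "1 * C'"]) auto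
    then show "\<forall>\<^sub>F n in sequentially. nth_diameter n E < a"
      using eventually_ge_at_top[of 2]
      by eventually_elim (use *[OF _ A(1) _ A(2)] C C' in \<open>fastforce intro: le_less_trans\<close>)
  qed
  then show ?thesis by (simp add: C_def)
qed

text \<open>The map \<open>s + c * x\<close> takes the value \<open>s\<close> at \<open>0\<close>,
  which the general theorem requires to be nonzero; so radius \<open>0\<close> is treated by
  itself.\<close>

lemma tendsto_nth_diameter_cball:
  assumes "0 \<le> s"
  shows "(\<lambda>n. nth_diameter n (cball c s)) \<longlonglongrightarrow> s"
proof (cases "s = 0")
  case True
  have "nth_diameter n {c} = 0" if "n \<ge> 2" for n
  proof -
    have "(\<Prod>j<n. \<Prod>i<j. cmod (z i - z j)) = 0" if "z \<in> {..<n} \<rightarrow> {c}" for z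
    proof (rule prod_zero)
      have "z 0 = z 1" using Pi_mem[OF that, of 0] Pi_mem[OF that, of 1] \<open>n \<ge> 2\<close> by simp
      then show "\<exists>j\<in>{..<n}. (\<Prod>i<j. cmod (z i - z j)) = 0"
        using \<open>n \<ge> 2\<close> by (intro bexI[of _ 1]) auto
    qed simp
    then show ?thesis
      unfolding nth_diameter_def by (subst SUP_cong[OF refl, where D = "\<lambda>_. 0"]) auto
  qed
  then have "\<forall>\<^sub>F n in sequentially. nth_diameter n {c} = 0"
    by (auto simp: eventually_sequentially)
  then show ?thesis using True by (simp add: tendsto_eventually)
next
  case False
  have "(\<lambda>n. nth_diameter n (cball c s)) \<longlonglongrightarrow> cmod (of_real s + c * 0)"
  proof (rule tendsto_nth_diameter)
    show "of_real s + c * x \<noteq> z * x" if "cmod x < 1" "z \<in> cball c s" for x z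
    proof
      assume "of_real s + c * x = z * x"
      then have "of_real s = (z - c) * x" by (simp add: algebra_simps)
      then have "cmod (of_real s) = cmod ((z - c) * x)" by simp
      then have "s = cmod (z - c) * cmod x" using assms by (simp add: norm_mult)
      also have "\<dots> \<le> s * cmod x" using that by (intro mult_right_mono) (auto simp: dist_norm norm_minus_commute)
      also have "\<dots> < s" using that assms False by simp
      finally show False by simp
    qed
    show "(of_real s + c * x) / x \<in> cball c s" if "cmod x = 1" for x
    proof -
      have "c - (of_real s + c * x) / x = - (of_real s / x)"
        using norm_eq_zero[of x] that by (simp add: field_simps del: norm_eq_zero)
      then show ?thesis using that assms by (simp add: dist_norm norm_divide)
    qed
  qed (use assms in \<open>auto intro!: holomorphic_intros continuous_intros\<close>)
  then show ?thesis using assms by simp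
qed

lemma transfinite_diameter_eqI:
  assumes "(\<lambda>n. nth_diameter n E) \<longlonglongrightarrow> C" "E \<noteq> {}"
  shows "transfinite_diameter E = C"
  using assms by (simp add: transfinite_diameter_def limI)

section \<open>Behaviour under scaling\<close>

lemma nth_diameter_scale:
  assumes "bounded E" "E \<noteq> {}" "\<xi> \<noteq> 0" "n \<ge> 2"
  shows "nth_diameter n ((\<lambda>z. \<xi> * z) ` E) = cmod \<xi> * nth_diameter n E"
proof -
  define N where "N = n choose 2"
  have N: "N > 0" unfolding N_def using assms by simp
  define P where "P z = (\<Prod>j<n. \<Prod>i<j. cmod (z i - z j))" for z :: "nat \<Rightarrow> complex"
  have P0: "P z \<ge> 0" for z unfolding P_def by (intro prod_nonneg ballI) auto
  have card: "(\<Prod>j<n. \<Prod>i<j. c) = c ^ N" for c :: real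
    unfolding N_def by (induction n) (auto simp: choose_2_simps power_add)
  have P: "P (\<lambda>i. \<xi> * z i) powr (1 / N) = cmod \<xi> * P z powr (1 / N)" for z
  proof -
    have "P (\<lambda>i. \<xi> * z i) = cmod \<xi> ^ N * P z"
      by (simp add: P_def norm_mult prod.distrib card[symmetric] flip: right_diff_distrib)
    also have "\<dots> powr (1 / N) = (cmod \<xi> powr N) powr (1 / N) * P z powr (1 / N)"
      using P0 assms by (simp add: powr_mult powr_realpow)
    finally show ?thesis using N assms by (simp add: powr_powr)
  qed
  obtain B where B: "\<And>z. z \<in> E \<Longrightarrow> cmod z \<le> B" using assms(1) by (auto simp: bounded_iff)
  have "P z \<le> (2 * B) ^ N" if z: "z \<in> {..<n} \<rightarrow> E" for z
    unfolding P_def card[symmetric]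
  proof (intro prod_mono conjI prod_nonneg)
    fix j i assume "j \<in> {..<n}" "i \<in> {..<j}"
    then have "cmod (z i) \<le> B" "cmod (z j) \<le> B" using z B by (auto simp: Pi_iff)
    then show "cmod (z i - z j) \<le> 2 * B" using norm_triangle_ineq4[of "z i" "z j"] by simp
  qed auto
  then have "P z powr (1 / N) \<le> ((2 * B) ^ N) powr (1 / N)" if "z \<in> {..<n} \<rightarrow> E" for z
    using P0 that by (intro powr_mono2) auto
  \<comment> \<open>Boundedness of \<open>E\<close> enters here: pulling the factor
    \<open>cmod \<xi>\<close> out of a supremum of reals takes an upper bound.\<close>
  then have bdd: "bdd_above ((\<lambda>z. P z powr (1 / N)) ` ({..<n} \<rightarrow> E))"
    by (auto simp: bdd_above_def)
  have ne: "{..<n} \<rightarrow> E \<noteq> {}" using assms(2) by auto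
  have img: "({..<n} \<rightarrow> (\<lambda>z. \<xi> * z) ` E) = (\<lambda>z i. \<xi> * z i) ` ({..<n} \<rightarrow> E)"
  proof (intro set_eqI iffI)
    fix w assume "w \<in> {..<n} \<rightarrow> (\<lambda>z. \<xi> * z) ` E"
    then have "(\<lambda>i. w i / \<xi>) \<in> {..<n} \<rightarrow> E" "\<And>i. w i = \<xi> * (w i / \<xi>)"
      using assms(3) by (force simp: Pi_iff)+
    then show "w \<in> (\<lambda>z i. \<xi> * z i) ` ({..<n} \<rightarrow> E)"
      by (intro image_eqI[where x = "\<lambda>i. w i / \<xi>"] ext)
  qed auto
  have cont: "continuous (at_left t) ((*) (cmod \<xi>))" for t
    by (intro continuous_intros)
  have "nth_diameter n ((\<lambda>z. \<xi> * z) ` E) = (SUP z \<in> {..<n} \<rightarrow> E. P (\<lambda>i. \<xi> * z i) powr (1 / N))"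
    by (simp add: nth_diameter_def img image_image P_def N_def)
  also have "\<dots> = (SUP z \<in> {..<n} \<rightarrow> E. cmod \<xi> * P z powr (1 / N))"
    by (simp only: P)
  also have "\<dots> = cmod \<xi> * (SUP z \<in> {..<n} \<rightarrow> E. P z powr (1 / N))"
    using continuous_at_Sup_mono[of "(*) (cmod \<xi>)" "(\<lambda>z. P z powr (1 / N)) ` ({..<n} \<rightarrow> E)"] bdd ne cont
    by (simp add: image_image mono_def mult_left_mono)
  finally show ?thesis by (simp add: nth_diameter_def P_def N_def)
qed

text \<open>\<open>lim\<close> is unspecified for a divergent sequence, so convergence has to be
  supplied; for two disks this is \<open>convergent_nth_diameter_two_disks\<close>.\<close>

lemma transfinite_diameter_scale:
  assumes "bounded E" "\<xi> \<noteq> 0" "E \<noteq> {} \<Longrightarrow> convergent (\<lambda>n. nth_diameter n E)"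
  shows "transfinite_diameter ((\<lambda>z. \<xi> * z) ` E) = cmod \<xi> * transfinite_diameter E"
proof (cases "E = {}")
  case False
  with assms obtain L where L: "(\<lambda>n. nth_diameter n E) \<longlonglongrightarrow> L" by (auto simp: convergent_def)
  have "\<forall>\<^sub>F n in sequentially. cmod \<xi> * nth_diameter n E = nth_diameter n ((\<lambda>z. \<xi> * z) ` E)"
    using eventually_ge_at_top[of 2]
    by eventually_elim (use nth_diameter_scale[OF assms(1) False assms(2)] in auto)
  then have "(\<lambda>n. nth_diameter n ((\<lambda>z. \<xi> * z) ` E)) \<longlonglongrightarrow> cmod \<xi> * L"
    by (rule Lim_transform_eventually[rotated]) (intro tendsto_intros L)
  then show ?thesis using L False by (simp add: transfinite_diameter_eqI)
qed (simp add: transfinite_diameter_def)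

section \<open>The exterior map of a lens\<close>

lemma Re_one_minus_pos:
  fixes w :: complex
  assumes "cmod w \<le> 1" "w \<noteq> 1"
  shows "Re (1 - w) > 0"
proof -
  have "Re w \<noteq> 1"
  proof
    assume "Re w = 1"
    moreover have "(Re w)\<^sup>2 + (Im w)\<^sup>2 \<le> 1"
      using power_mono[OF assms(1), of 2] by (simp add: cmod_power2)
    ultimately have "Im w = 0" by simp
    with \<open>Re w = 1\<close> have "w = 1" by (simp add: complex_eq_iff)
    with assms(2) show False ..
  qed
  moreover have "Re w \<le> 1" using complex_Re_le_cmod[of w] assms(1) by linarith
  ultimately show ?thesis by simp
qed

lemma powr_polar:
  fixes w :: complex
  assumes "Re w > 0"
  shows "w powr of_real q = of_real (cmod w powr q) * cis (q * Im (Ln w))"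
proof -
  have "w \<noteq> 0" using assms by auto
  then show ?thesis
    by (simp add: powr_def exp_eq_polar Re_Ln mult.commute) 
qed

lemma polar_Ln:
  fixes w :: complex
  assumes "Re w > 0"
  shows "w = of_real (cmod w) * cis (Im (Ln w))"
proof -
  have "w \<noteq> 0" using assms by auto
  then have "w = exp (Ln w)" by simp
  then show ?thesis using \<open>w \<noteq> 0\<close> by (subst (asm) exp_eq_polar) (simp add: Re_Ln)
qed

text \<open>The map \<open>A / B \<mapsto> (u A - cnj u B) / (A - B)\<close> sends \<open>0\<close> to \<open>cnj u\<close>, \<open>1\<close> to \<open>\<infinity>\<close> and
  \<open>\<infinity>\<close> to \<open>u\<close>, hence lines through \<open>0\<close> to circles through \<open>u\<close> and \<open>cnj u\<close>.\<close>

lemma cmod_moebius_le_iff: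
  assumes "A \<noteq> B" "Im u > 0"
  shows "cmod ((u * A - cnj u * B) / (A - B)) \<le> cmod u \<longleftrightarrow> Im (u * A * cnj B) \<le> 0"
proof -
  have "(cmod (u * A - cnj u * B))\<^sup>2 - (cmod u * cmod (A - B))\<^sup>2 = 4 * Im u * Im (u * A * cnj B)"
    unfolding power_mult_distrib cmod_power2 by (simp add: power2_eq_square algebra_simps)
  moreover have "cmod ((u * A - cnj u * B) / (A - B)) \<le> cmod u \<longleftrightarrow>
      cmod (u * A - cnj u * B) \<le> cmod u * cmod (A - B)"
    using assms(1) by (simp add: norm_divide divide_le_eq)
  moreover have "\<dots> \<longleftrightarrow> (cmod (u * A - cnj u * B))\<^sup>2 \<le> (cmod u * cmod (A - B))\<^sup>2"
    by (meson norm_ge_zero mult_nonneg_nonneg power2_le_imp_le power_mono)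
  ultimately have "cmod ((u * A - cnj u * B) / (A - B)) \<le> cmod u \<longleftrightarrow> 4 * Im u * Im (u * A * cnj B) \<le> 0"
    by linarith
  then show ?thesis using assms(2) by (auto simp: mult_le_0_iff)
qed

text \<open>\<open>a * cnj b\<close> has the argument of \<open>a / b\<close> and still makes sense
  at the corner \<open>x = 1\<close>, where the denominator \<open>B\<close> below vanishes.\<close>

lemma cnj_polar_mult:
  "(of_real a * cis t) * cnj (of_real b * cis t') = of_real (a * b) * cis (t - t')"
  by (simp add: cis_cnj cis_mult[symmetric] diff_conv_add_uminus del: add_uminus_conv_diff)

text \<open>The triangle with vertices \<open>0\<close>, \<open>1\<close>, \<open>u\<close> has
  angle \<theta> at \<open>0\<close> and \<phi> at \<open>1\<close>. The radii at \<open>u\<close>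
  therefore meet at \<open>pi - \<theta> - \<phi>\<close>, and \<open>\<theta> + \<phi>\<close> is
  the interior angle \<alpha> of the lens.\<close>

locale lens =
  fixes r s \<theta> \<phi> :: real and u :: complex
  assumes r: "r > 0" and s: "s > 0" and angles: "\<theta> > 0" "\<phi> > 0" "\<theta> + \<phi> < pi"
    and u_r: "u = of_real r * cis \<theta>" and u_s: "u = 1 - of_real s * cis (- \<phi>)"
begin

definition q :: real where "q = (2 * pi - \<theta> - \<phi>) / pi"
definition \<beta> :: real where "\<beta> = (pi - \<phi>) / q"
text \<open>\<open>(1 - \<kappa> * x) / (1 - x)\<close> maps the open unit disk onto the half-plane
  of arguments between \<open>- \<beta>\<close> and \<open>pi - \<beta>\<close>, with
  \<open>0\<close> going to \<open>1\<close>. By the choice of \<beta> the \<open>q\<close>-th power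
  opens it to the sector between \<open>- (pi - \<phi>)\<close> and
  \<open>pi - \<theta>\<close>.\<close>

definition \<kappa> :: complex where "\<kappa> = cis (- 2 * \<beta>)"
text \<open>Separate powers keep both bases in the closed right half-plane, away from the branch cut
  except for \<open>0\<close>, and stay finite at the corners \<open>x = 1\<close> and
  \<open>\<kappa> * x = 1\<close>.\<close>

definition A :: "complex \<Rightarrow> complex" where "A x = (1 - \<kappa> * x) powr of_real q"
definition B :: "complex \<Rightarrow> complex" where "B x = (1 - x) powr of_real q"
definition \<delta> :: "complex \<Rightarrow> real" where "\<delta> x = Im (Ln (1 - \<kappa> * x)) - Im (Ln (1 - x))"

lemma q: "q > 1"
  using angles by (simp add: q_def field_simps)

lemma q_\<beta>: "q * \<beta> = pi - \<phi>" "q * (pi - \<beta>) = pi - \<theta>"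
proof -
  show 1: "q * \<beta> = pi - \<phi>" using q by (simp add: \<beta>_def)
  have "q * pi = 2 * pi - \<theta> - \<phi>" by (simp add: q_def)
  with 1 show "q * (pi - \<beta>) = pi - \<theta>" by (simp add: right_diff_distrib)
qed

lemma \<beta>: "0 < \<beta>" "\<beta> < pi"
proof -
  have "q * \<beta> > 0" "q * (pi - \<beta>) > 0" using q_\<beta> angles by auto
  then show "0 < \<beta>" "\<beta> < pi" using q by (auto simp: zero_less_mult_iff)
qed

lemma Im_u: "Im u > 0"
  using r angles by (auto simp: u_r intro!: mult_pos_pos sin_gt_zero)

lemma cmod_u: "cmod u = r" "cmod (u - 1) = s"
  using r s by (simp_all add: u_r norm_mult) (simp add: u_s[unfolded u_r] norm_mult)

lemma u_minus_1: "u - 1 = of_real s * cis (pi - \<phi>)"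
  by (simp add: u_s complex_eq_iff)

lemma cmod_\<kappa>: "cmod \<kappa> = 1"
  by (simp add: \<kappa>_def)

lemma cmod_one_minus_\<kappa>: "cmod (1 - \<kappa>) = 2 * sin \<beta>"
proof -
  have "(cmod (1 - \<kappa>))\<^sup>2 = (1 - cos (2 * \<beta>))\<^sup>2 + (sin (2 * \<beta>))\<^sup>2"
    by (simp add: cmod_power2 \<kappa>_def)
  also have "\<dots> = 2 - 2 * cos (2 * \<beta>)"
    using sin_cos_squared_add[of "2 * \<beta>"] by (simp add: power2_eq_square algebra_simps)
  also have "\<dots> = (2 * sin \<beta>)\<^sup>2"
    by (simp add: cos_double_sin power_mult_distrib)
  finally show ?thesis
    by (rule power2_eq_imp_eq) (use \<beta> in \<open>auto intro!: sin_ge_zero\<close>)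
qed

lemma \<kappa>_neq_1: "\<kappa> \<noteq> 1"
  using cmod_one_minus_\<kappa> sin_gt_zero[OF \<beta>] by auto

section \<open>The argument of \<open>A / B\<close> on the closed disk\<close>

context
  fixes x :: complex
  assumes x: "cmod x \<le> 1" "x \<noteq> 1" "\<kappa> * x \<noteq> 1"
begin

lemma Re_pos: "Re (1 - \<kappa> * x) > 0" "Re (1 - x) > 0"
  using x cmod_\<kappa> Re_one_minus_pos[of "\<kappa> * x"] Re_one_minus_pos[of x] by (auto simp: norm_mult)

lemma AB_polar: "\<exists>R>0. A x * cnj (B x) = of_real R * cis (q * \<delta> x)"
proof -
  have "1 - \<kappa> * x \<noteq> 0" "1 - x \<noteq> 0" using x by auto
  then show ?thesis
    unfolding A_def B_def powr_polar[OF Re_pos(1)] powr_polar[OF Re_pos(2)] cnj_polar_mult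
    by (intro exI[of _ "cmod (1 - \<kappa> * x) powr q * cmod (1 - x) powr q"])
       (simp add: \<delta>_def right_diff_distrib)
qed

lemma \<delta>_bound: "\<bar>\<delta> x\<bar> < pi"
  using Re_Ln_pos_lt[of "1 - \<kappa> * x"] Re_Ln_pos_lt[of "1 - x"] Re_pos x by (auto simp: \<delta>_def)

text \<open>Since \<open>cis \<beta> * \<kappa> = cnj (cis \<beta>)\<close>, rotating
  \<open>(1 - \<kappa> * x) * cnj (1 - x)\<close> by \<beta> leaves an imaginary part that depends
  on \<open>cmod x\<close> alone. Up to a positive factor it is the signed distance of the Moebius
  image from the line bounding the half-plane.\<close>

lemma sin_\<beta>_\<delta>: "\<exists>K>0. sin (\<beta> + \<delta> x) * K = sin \<beta> * (1 - (cmod x)\<^sup>2)"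
proof -
  define K where "K = cmod (1 - \<kappa> * x) * cmod (1 - x)"
  have K: "K > 0" using x by (simp add: K_def)
  have "(1 - \<kappa> * x) * cnj (1 - x) = of_real K * cis (\<delta> x)"
    unfolding K_def \<delta>_def cnj_polar_mult[symmetric] using polar_Ln[OF Re_pos(1)] polar_Ln[OF Re_pos(2)] by simp
  then have "cis \<beta> * ((1 - \<kappa> * x) * cnj (1 - x)) = of_real K * cis (\<beta> + \<delta> x)"
    by (simp add: cis_mult[symmetric] mult.commute mult.left_commute)
  moreover have "cis \<beta> * ((1 - \<kappa> * x) * cnj (1 - x)) = (cis \<beta> - cnj (cis \<beta>) * x) * (1 - cnj x)"
    by (simp add: \<kappa>_def cis_cnj right_diff_distrib cis_mult mult.assoc[symmetric])
  moreover have "Im ((cis \<beta> - cnj (cis \<beta>) * x) * (1 - cnj x)) = sin \<beta> * (1 - (cmod x)\<^sup>2)"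
    unfolding cmod_power2 by (simp add: power2_eq_square algebra_simps)
  ultimately have "Im (of_real K * cis (\<beta> + \<delta> x)) = sin \<beta> * (1 - (cmod x)\<^sup>2)" by metis
  then show ?thesis using K by (intro exI[of _ K]) (simp add: mult.commute)
qed

text \<open>By \<open>\<delta>_bound\<close> the angle \<open>\<beta> + \<delta> x\<close> lies in
  \<open>(- pi, 2 * pi)\<close>, where a positive sine means an angle in
  \<open>(0, pi)\<close>.\<close>

lemma \<delta>_inside:
  assumes "cmod x < 1"
  shows "- (pi - \<phi>) < q * \<delta> x" "q * \<delta> x < pi - \<theta>"
proof -
  obtain K where K: "K > 0" "sin (\<beta> + \<delta> x) * K = sin \<beta> * (1 - (cmod x)\<^sup>2)" using sin_\<beta>_\<delta> by blast
  have "(cmod x)\<^sup>2 < 1" using assms by (simp add: power_less_one_iff)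
  then have "sin \<beta> * (1 - (cmod x)\<^sup>2) > 0" using sin_gt_zero[OF \<beta>] by simp
  then have "sin (\<beta> + \<delta> x) * K > 0" using K(2) by simp
  then have sin: "sin (\<beta> + \<delta> x) > 0" using K(1) by (simp only: zero_less_mult_iff) auto
  have "\<beta> + \<delta> x > 0"
  proof (rule ccontr)
    assume "\<not> \<beta> + \<delta> x > 0"
    then have "sin (- (\<beta> + \<delta> x)) \<ge> 0" using \<delta>_bound \<beta> by (intro sin_ge_zero) linarith+
    then show False using sin unfolding sin_minus by linarith
  qed
  moreover have "\<beta> + \<delta> x < pi"
    using sin_le_zero[of "\<beta> + \<delta> x"] sin \<delta>_bound \<beta> by (cases "\<beta> + \<delta> x < pi") auto
  ultimately have "q * (- \<beta>) < q * \<delta> x" "q * \<delta> x < q * (pi - \<beta>)"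
    using q by (intro mult_strict_left_mono; linarith)+
  then show "- (pi - \<phi>) < q * \<delta> x" "q * \<delta> x < pi - \<theta>" using q_\<beta> by auto
qed

lemma \<delta>_boundary:
  assumes "cmod x = 1"
  shows "q * \<delta> x = - (pi - \<phi>) \<or> q * \<delta> x = pi - \<theta>"
proof -
  obtain K where K: "K > 0" "sin (\<beta> + \<delta> x) * K = sin \<beta> * (1 - (cmod x)\<^sup>2)" using sin_\<beta>_\<delta> by blast
  then have sin: "sin (\<beta> + \<delta> x) = 0" using assms by simp
  have "\<beta> + \<delta> x = 0 \<or> \<beta> + \<delta> x = pi"
    using sin_gt_zero[of "- (\<beta> + \<delta> x)"] sin_gt_zero[of "\<beta> + \<delta> x"] sin_lt_zero[of "\<beta> + \<delta> x"] 
      sin \<delta>_bound \<beta> by (smt (verit) sin_minus)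
  then have "q * \<delta> x = q * (- \<beta>) \<or> q * \<delta> x = q * (pi - \<beta>)"
    by (metis add.commute add.inverse_inverse add_diff_cancel_left' diff_minus_eq_add eq_neg_iff_add_eq_0)
  then show ?thesis using q_\<beta> by auto
qed

text \<open>No point except \<open>0\<close> goes to \<infinity>. Raising to a power above
  \<open>1\<close> could identify distinct points; the angle \<open>q * \<delta> x\<close> staying
  inside \<open>(- pi, pi)\<close> prevents it.\<close>

lemma A_neq_B:
  assumes "x \<noteq> 0"
  shows "A x \<noteq> B x"
proof
  assume eq: "A x = B x"
  obtain R where R: "R > 0" "A x * cnj (B x) = of_real R * cis (q * \<delta> x)" using AB_polar by blast
  then have "of_real R * cis (q * \<delta> x) = of_real ((cmod (B x))\<^sup>2)"
    by (metis eq complex_norm_square)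
  then have "Im (of_real R * cis (q * \<delta> x)) = 0" by (simp only: Im_complex_of_real)
  then have sin: "sin (q * \<delta> x) = 0" using R(1) by simp
  have range: "- pi < q * \<delta> x" "q * \<delta> x < pi"
    using \<delta>_inside \<delta>_boundary angles x(1) by (cases "cmod x = 1"; fastforce)+
  have zero: "q * \<delta> x = 0"
    using sin_gt_zero[of "q * \<delta> x"] sin_gt_zero[of "- (q * \<delta> x)"] sin range by (smt (verit) sin_minus)
  then have Ln: "Im (Ln (1 - \<kappa> * x)) = Im (Ln (1 - x))" using q by (simp add: \<delta>_def)
  have "cmod (1 - \<kappa> * x) powr q = cmod (1 - x) powr q"
    using arg_cong[OF eq, of cmod] unfolding A_def B_def powr_polar[OF Re_pos(1)] powr_polar[OF Re_pos(2)]
    by (simp add: norm_mult)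
  then have "(cmod (1 - \<kappa> * x) powr q) powr (1 / q) = (cmod (1 - x) powr q) powr (1 / q)"
    by (simp only:)
  then have "cmod (1 - \<kappa> * x) = cmod (1 - x)"
    using q by (simp add: powr_powr)
  then have "1 - \<kappa> * x = 1 - x"
    using polar_Ln[OF Re_pos(1)] polar_Ln[OF Re_pos(2)] Ln by metis
  then show False using \<kappa>_neq_1 assms by simp
qed

end

text \<open>\<open>(z - cnj u) / (z - u)\<close> maps the complement of the lens onto a sector with opening angle
  \<open>pi * q = 2 * pi - \<theta> - \<phi>\<close>; the disk is mapped onto the same sector by \<open>A / B\<close>, with \<open>0\<close> going to
  \<open>1\<close>, the image of \<open>\<infinity>\<close>. Solving for \<open>z\<close> gives \<open>z = \<psi> x / x\<close>; \<open>D\<close> is \<open>(A - B) / x\<close> with its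
  singularity at \<open>0\<close> removed.\<close>

definition D :: "complex \<Rightarrow> complex" where
  "D x = (if x = 0 then of_real q * (1 - \<kappa>) else (A x - B x) / x)"

definition \<psi> :: "complex \<Rightarrow> complex" where
  "\<psi> x = (u * A x - cnj u * B x) / D x"

section \<open>Regularity of \<psi> up to the unit circle\<close>

lemma Re_nonneg:
  assumes "x \<in> cball 0 1"
  shows "Re (1 - \<kappa> * x) \<ge> 0" "Re (1 - x) \<ge> 0"
  using assms complex_Re_le_cmod[of x] complex_Re_le_cmod[of "\<kappa> * x"] cmod_\<kappa>
  by (simp_all add: norm_mult del: complex_Re_le_cmod)

lemma continuous_AB: "continuous_on (cball 0 1) A" "continuous_on (cball 0 1) B"
  unfolding A_def B_def using q Re_nonneg
  by (intro continuous_on_powr_complex continuous_intros; auto)+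

lemma ball_nonpos_Reals:
  assumes "x \<in> ball 0 1"
  shows "1 - \<kappa> * x \<notin> \<real>\<^sub>\<le>\<^sub>0" "1 - x \<notin> \<real>\<^sub>\<le>\<^sub>0"
proof -
  have "cmod x < 1" "cmod (\<kappa> * x) < 1" using assms cmod_\<kappa> by (auto simp: norm_mult)
  then have "Re (1 - x) > 0" "Re (1 - \<kappa> * x) > 0"
    using Re_one_minus_pos[of x] Re_one_minus_pos[of "\<kappa> * x"] by force+
  then show "1 - \<kappa> * x \<notin> \<real>\<^sub>\<le>\<^sub>0" "1 - x \<notin> \<real>\<^sub>\<le>\<^sub>0"
    by (auto simp: complex_nonpos_Reals_iff)
qed

lemma holomorphic_AB: "A holomorphic_on ball 0 1" "B holomorphic_on ball 0 1"
  unfolding A_def B_def by (intro holomorphic_intros ball_nonpos_Reals; assumption)+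

lemma deriv_AB: "deriv (\<lambda>x. A x - B x) 0 = of_real q * (1 - \<kappa>)"
proof -
  have "((\<lambda>x. (1 - k * x) powr of_real q) has_field_derivative of_real q * 1 * (- k)) (at 0)"
    for k :: complex
    using DERIV_chain2[where f = "\<lambda>w. w powr of_real q" and g = "\<lambda>x. 1 - k * x" and x = 0 and s = UNIV
        and Db = "- k", OF has_field_derivative_powr]
    by (auto intro!: derivative_eq_intros)
  from DERIV_imp_deriv[OF DERIV_diff[OF this[of \<kappa>] this[of 1]]]
  have "deriv (\<lambda>x. A x - B x) 0 = of_real q * 1 * - \<kappa> - of_real q * 1 * - 1"
    by (simp only: A_def B_def mult_1_left)
  then show ?thesis by (simp add: right_diff_distrib)
qed

text \<open>These are the preimages of the corners: \<open>\<psi> x / x\<close> is \<open>u\<close>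
  at \<open>x = 1\<close> and \<open>cnj u\<close> where \<open>\<kappa> * x = 1\<close>. The
  vanishing rests on \<open>0 powr _ = 0\<close>.\<close>

lemma AB_at_unit:
  "B 1 = 0" "A 1 \<noteq> 0" "\<kappa> * x = 1 \<Longrightarrow> A x = 0" "\<kappa> * x = 1 \<Longrightarrow> B x \<noteq> 0"
  using \<kappa>_neq_1 by (auto simp: A_def B_def)

lemma D_holomorphic: "D holomorphic_on ball 0 1"
proof (rule pole_theorem_open_0[where g = "\<lambda>x. A x - B x" and a = 0])
  show "(\<lambda>x. A x - B x) holomorphic_on ball 0 1"
    by (intro holomorphic_intros holomorphic_AB)
  show "D 0 = deriv (\<lambda>x. A x - B x) 0" by (simp add: D_def deriv_AB)
qed (auto simp: D_def A_def B_def)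

lemma D_continuous: "continuous_on (cball 0 1) D"
  unfolding continuous_on_eq_continuous_within
proof
  fix x :: complex assume x: "x \<in> cball 0 1"
  show "continuous (at x within cball 0 1) D"
  proof (cases "x = 0")
    case True
    then have "isCont D x"
      using holomorphic_on_imp_continuous_on[OF D_holomorphic] by (simp add: continuous_on_eq_continuous_at)
    then show ?thesis by (rule continuous_at_imp_continuous_within)
  next
    case False
    have "continuous (at x within cball 0 1) (\<lambda>x. (A x - B x) / x)"
      using continuous_AB x False unfolding continuous_on_eq_continuous_within
      by (intro continuous_intros) auto
    then show ?thesis
      by (rule continuous_transform_within[where \<delta> = "cmod x"]) (use False x in \<open>auto simp: D_def\<close>)
  qed
qed

lemma D_nz:
  assumes "cmod x \<le> 1"
  shows "D x \<noteq> 0"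
proof (cases "x = 0")
  case True
  then show ?thesis using q \<kappa>_neq_1 by (simp add: D_def)
next
  case False
  have "A x \<noteq> B x"
    using A_neq_B[OF assms _ _ False] AB_at_unit by (cases "x = 1"; cases "\<kappa> * x = 1") auto
  then show ?thesis using False by (simp add: D_def)
qed

lemma \<psi>_holomorphic: "\<psi> holomorphic_on ball 0 1"
  unfolding \<psi>_def using D_nz by (intro holomorphic_intros holomorphic_AB D_holomorphic) auto

lemma \<psi>_continuous: "continuous_on (cball 0 1) \<psi>"
  unfolding \<psi>_def using D_nz by (intro continuous_intros continuous_AB D_continuous) auto

lemma \<psi>_div:
  assumes "x \<noteq> 0"
  shows "\<psi> x / x = (u * A x - cnj u * B x) / (A x - B x)"
  using assms by (simp add: \<psi>_def D_def)

text \<open>Both centres are real, so shifting by \<open>- 1\<close> turns \<open>u\<close>,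
  \<open>cnj u\<close> into \<open>u - 1\<close>, \<open>cnj (u - 1)\<close>, and the criterion for
  a disk about \<open>0\<close> also covers the one about \<open>1\<close>.\<close>

lemma mem_lens_iff:
  assumes "a \<noteq> b"
  shows "(u * a - cnj u * b) / (a - b) \<in> cball 0 r \<inter> cball 1 s \<longleftrightarrow>
    Im (u * (a * cnj b)) \<le> 0 \<and> Im ((u - 1) * (a * cnj b)) \<le> 0"
proof -
  have "(u * a - cnj u * b) / (a - b) - 1 = ((u - 1) * a - cnj (u - 1) * b) / (a - b)"
    using assms by (simp add: field_simps)
  then show ?thesis
    using cmod_moebius_le_iff[OF assms Im_u] cmod_moebius_le_iff[OF assms, of "u - 1"] Im_u
    by (simp add: dist_norm norm_minus_commute[of 1] cmod_u mult.assoc)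
qed

lemma Im_u_polar:
  "Im (u * (of_real R * cis y)) = r * R * sin (\<theta> + y)"
  "Im ((u - 1) * (of_real R * cis y)) = s * R * sin (pi - \<phi> + y)"
proof -
  show "Im (u * (of_real R * cis y)) = r * R * sin (\<theta> + y)"
    by (simp add: u_r sin_add algebra_simps)
  show "Im ((u - 1) * (of_real R * cis y)) = s * R * sin (pi - \<phi> + y)"
    unfolding u_minus_1 sin_add[of "pi - \<phi>"] by (simp add: algebra_simps)
qed

lemma \<psi>_inside:
  assumes x: "cmod x < 1" and z: "z \<in> cball 0 r \<inter> cball 1 s"
  shows "\<psi> x \<noteq> z * x"
proof (cases "x = 0")
  case True
  have "u \<noteq> cnj u" using Im_u by (auto simp: complex_eq_iff)
  then show ?thesis using True q \<kappa>_neq_1 by (simp add: \<psi>_def D_def A_def B_def)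
next
  case False
  have neq: "x \<noteq> 1" "\<kappa> * x \<noteq> 1" "cmod x \<le> 1"
    using x cmod_\<kappa> norm_mult[of \<kappa> x] by auto
  obtain R where R: "R > 0" "A x * cnj (B x) = of_real R * cis (q * \<delta> x)" using AB_polar[OF neq(3,1,2)] by blast
  note y = \<delta>_inside[OF neq(3,1,2) x]
  show ?thesis
  proof
    assume "\<psi> x = z * x"
    then have "z = \<psi> x / x" using False by simp
    with z have "\<psi> x / x \<in> cball 0 r \<inter> cball 1 s" by simp
    then have "r * R * sin (\<theta> + q * \<delta> x) \<le> 0" "s * R * sin (pi - \<phi> + q * \<delta> x) \<le> 0"
      using mem_lens_iff[OF A_neq_B[OF neq(3,1,2) False]] unfolding \<psi>_div[OF False] R(2) Im_u_polar by auto
    then have "sin (\<theta> + q * \<delta> x) \<le> 0" "sin (pi - \<phi> + q * \<delta> x) \<le> 0"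
      using r s R by (auto simp: mult_le_0_iff)
    \<comment> \<open>By \<open>y\<close> the first angle is below \<open>pi\<close> and the second
      above \<open>0\<close>, so the signs of the sines force
      \<open>q * \<delta> x \<le> - \<theta>\<close> and
      \<open>q * \<delta> x \<ge> \<phi>\<close>.\<close>
    then have "\<theta> + q * \<delta> x \<le> 0" "pi - \<phi> + q * \<delta> x \<ge> pi"
      using sin_gt_zero[of "\<theta> + q * \<delta> x"] sin_gt_zero[of "pi - \<phi> + q * \<delta> x"] y angles by linarith+
    then show False using angles by linarith
  qed
qed

text \<open>Each boundary ray of the sector corresponds to one arc: on \<open>pi - \<theta>\<close>
  the first sine vanishes (circle about \<open>0\<close>), on \<open>- (pi - \<phi>)\<close> the
  second (circle about \<open>1\<close>). The other sine is \<open>- sin (\<theta> + \<phi>)\<close>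
  each time.\<close>

lemma \<psi>_boundary:
  assumes x: "cmod x = 1"
  shows "\<psi> x / x \<in> cball 0 r \<inter> cball 1 s"
proof -
  have x0: "x \<noteq> 0" and x1: "cmod x \<le> 1" using x by auto
  have neq: "A x \<noteq> B x" using D_nz[OF x1] x0 by (auto simp: D_def)
  have "Im (u * (A x * cnj (B x))) \<le> 0 \<and> Im ((u - 1) * (A x * cnj (B x))) \<le> 0"
  proof (cases "x = 1 \<or> \<kappa> * x = 1")
    case True
    then show ?thesis using AB_at_unit by auto
  next
    case False
    then have ne: "x \<noteq> 1" "\<kappa> * x \<noteq> 1" by auto
    obtain R where R: "R > 0" "A x * cnj (B x) = of_real R * cis (q * \<delta> x)" using AB_polar[OF x1 ne] by blast
    have "sin (\<theta> + q * \<delta> x) \<le> 0 \<and> sin (pi - \<phi> + q * \<delta> x) \<le> 0"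
      using \<delta>_boundary[OF x1 ne x]
    proof
      assume y: "q * \<delta> x = - (pi - \<phi>)"
      have "\<theta> + q * \<delta> x = - (pi - (\<theta> + \<phi>))" using y by simp
      then have "sin (\<theta> + q * \<delta> x) = - sin (\<theta> + \<phi>)" by (simp only: sin_minus sin_pi_minus)
      then show ?thesis using y sin_ge_zero[of "\<theta> + \<phi>"] angles by simp
    next
      assume y: "q * \<delta> x = pi - \<theta>"
      have "pi - \<phi> + q * \<delta> x = 2 * pi - (\<theta> + \<phi>)" using y by simp
      then have "sin (pi - \<phi> + q * \<delta> x) = - sin (\<theta> + \<phi>)" by (simp only: sin_2pi_minus)
      then show ?thesis using y sin_ge_zero[of "\<theta> + \<phi>"] angles by simp
    qed
    then show ?thesis
      unfolding R(2) Im_u_polar using r s R by (auto simp: mult_le_0_iff)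
  qed
  then show ?thesis unfolding \<psi>_div[OF x0] mem_lens_iff[OF neq] .
qed

text \<open>At \<open>0\<close> both powers are \<open>1\<close>, so the numerator is
  \<open>u - cnj u\<close>. The sine is written at \<open>pi - \<beta>\<close> because \<zeta> will
  be \<open>cis (pi - \<beta>)\<close>.\<close>

lemma cmod_\<psi>_0: "cmod (\<psi> 0) = 1 / (2 * sin (pi - \<beta>)) * (1 / q) * cmod (cnj u - u)"
  using q by (simp add: \<psi>_def D_def A_def B_def norm_divide norm_mult cmod_one_minus_\<kappa> norm_minus_commute[of u])

end

section \<open>Angles of a lens\<close>

text \<open>On an upper half circle about \<open>0\<close> the argument decreases as the real part
  grows, and \<open>Im (a * cnj b)\<close> has the sign of the sine of the difference of
  arguments.\<close>

lemma Im_mult_cnj_pos: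
  assumes "cmod a = cmod b" "Im a > 0" "Im b > 0" "Re a \<le> Re b" "a \<noteq> b"
  shows "Im (a * cnj b) > 0"
proof -
  have sq: "(Re a)\<^sup>2 + (Im a)\<^sup>2 = (Re b)\<^sup>2 + (Im b)\<^sup>2"
    using arg_cong[OF assms(1), of "\<lambda>t. t\<^sup>2"] by (simp add: cmod_power2)
  have "Re a \<noteq> Re b"
    using sq assms by (auto simp: complex_eq_iff power2_eq_iff_nonneg)
  then have lt: "Re a < Re b" using assms(4) by simp
  consider "Re b \<le> 0" | "Re b > 0" "Re a \<le> 0" | "Re a > 0" by linarith
  then have "Re a * Im b < Im a * Re b"
  proof cases
    case 1
    have "(Re b)\<^sup>2 < (Re a)\<^sup>2" using lt 1 power_strict_mono[of "- Re b" "- Re a" 2] by simp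
    then have "Im a < Im b" using sq assms(3) power2_less_imp_less[of "Im a" "Im b"] by linarith
    have "Re a * Im b < Re b * Im b" using lt assms(3) by simp
    also have "\<dots> \<le> Re b * Im a" using 1 \<open>Im a < Im b\<close> by (intro mult_left_mono_neg) auto
    finally show ?thesis by (simp add: mult.commute)
  next
    case 2
    then have "Re a * Im b \<le> 0" "0 < Im a * Re b" using assms by (auto simp: mult_nonpos_nonneg)
    then show ?thesis by linarith
  next
    case 3
    have "(Re a)\<^sup>2 < (Re b)\<^sup>2" using lt 3 by (intro power_strict_mono) auto
    then have "Im b < Im a" using sq assms(2) power2_less_imp_less[of "Im b" "Im a"] by linarith
    then have "Re a * Im b < Re a * Im a" using 3 by simp
    also have "\<dots> \<le> Re b * Im a" using lt assms by simp
    finally show ?thesis by (simp add: mult.commute)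
  qed
  then show ?thesis by simp
qed

text \<open>For \<open>\<bar>a\<bar> = \<bar>b\<bar>\<close> the chord \<open>a - b\<close> is perpendicular to \<open>a + b\<close>.\<close>

lemma sgn_chord:
  assumes "cmod a = cmod b" "\<epsilon> * Im (a * cnj b) > 0" "\<bar>\<epsilon>\<bar> = 1"
  shows "sgn (a - b) = of_real \<epsilon> * \<i> * sgn (a + b)"
proof -
  have ab: "a + b \<noteq> 0"
  proof
    assume "a + b = 0"
    then have "a = - b" by (simp add: add_eq_0_iff2)
    then have "Im (a * cnj b) = 0" by simp
    with assms(2) show False by simp
  qed
  have sq: "(Re a)\<^sup>2 + (Im a)\<^sup>2 = (Re b)\<^sup>2 + (Im b)\<^sup>2"
    using arg_cong[OF assms(1), of "\<lambda>t. t\<^sup>2"] by (simp add: cmod_power2)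
  have "(a - b) * cnj (a + b) = of_real (2 * Im (a * cnj b)) * \<i>"
    using sq by (simp add: complex_eq_iff power2_eq_square algebra_simps)
  then have "(a - b) * (cnj (a + b) * (a + b)) = of_real (2 * Im (a * cnj b)) * \<i> * (a + b)"
    by (simp only: mult.assoc[symmetric])
  then have "(a - b) * of_real ((cmod (a + b))\<^sup>2) = of_real (2 * Im (a * cnj b)) * \<i> * (a + b)"
    by (metis complex_norm_square mult.commute)
  then have "sgn (a - b) * sgn (of_real ((cmod (a + b))\<^sup>2)) =
      sgn (of_real (2 * Im (a * cnj b))) * sgn \<i> * sgn (a + b)"
    by (metis Real_Vector_Spaces.sgn_mult)
  moreover have "sgn (of_real ((cmod (a + b))\<^sup>2) :: complex) = 1"
    using ab by (subst sgn_of_real) simp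
  moreover have "sgn (of_real (2 * Im (a * cnj b)) :: complex) = of_real \<epsilon>"
    using assms(2,3) by (subst sgn_of_real) (auto simp: zero_less_mult_iff sgn_mult abs_if split: if_splits)
  moreover have "sgn \<i> = \<i>" by (simp add: sgn_div_norm)
  ultimately show ?thesis by simp
qed

text \<open>The normalized chord is \<open>\<epsilon> * \<i>\<close> times the direction of
  \<open>(z - c) + (u - c)\<close>, which is continuous at \<open>u\<close>. The sign \<epsilon> is
  \<open>1\<close> if the arc leaves \<open>u\<close> counterclockwise about \<open>c\<close>, and
  \<open>- 1\<close> if clockwise.\<close>

lemma half_tangent_circle:
  assumes A: "A \<subseteq> sphere c R" and u: "u islimpt A" "u \<in> sphere c R" "R > 0" and \<epsilon>: "\<bar>\<epsilon>\<bar> = 1"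
    and ev: "\<forall>\<^sub>F z in at u within A. \<epsilon> * Im ((z - c) * cnj (u - c)) > 0"
  shows "half_tangent A u = of_real \<epsilon> * \<i> * sgn (u - c)"
  unfolding half_tangent_def
proof (rule tendsto_Lim)
  show "at u within A \<noteq> bot" using u(1) by (simp add: trivial_limit_within)
  have norm: "cmod (z - c) = R" if "z \<in> sphere c R" for z
    using that by (simp add: dist_norm norm_minus_commute)
  have uc: "u - c \<noteq> 0" using norm[OF u(2)] u(3) by auto
  have memA: "\<forall>\<^sub>F z in at u within A. z \<in> A" by (simp add: eventually_at_filter)
  have eq: "\<forall>\<^sub>F z in at u within A. of_real \<epsilon> * \<i> * sgn ((z - c) + (u - c)) = sgn (z - u)"
    using ev memA
  proof eventually_elim
    case (elim z)
    then have "sgn ((z - c) - (u - c)) = of_real \<epsilon> * \<i> * sgn ((z - c) + (u - c))"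
      using A norm u(2) \<epsilon> by (intro sgn_chord) auto
    then show ?case by simp
  qed
  have lim: "((\<lambda>z. of_real \<epsilon> * \<i> * sgn ((z - c) + (u - c))) \<longlongrightarrow> of_real \<epsilon> * \<i> * sgn ((u - c) + (u - c)))
      (at u within A)"
    using uc by (intro tendsto_intros) (auto simp: mult_2[symmetric])
  have double: "sgn (w + w) = sgn w" for w :: complex
    by (simp add: sgn_div_norm norm_mult scaleR_conv_of_real flip: mult_2)
  show "((\<lambda>z. sgn (z - u)) \<longlongrightarrow> of_real \<epsilon> * \<i> * sgn (u - c)) (at u within A)"
    using Lim_transform_eventually[OF lim eq] by (simp only: double)
qed

lemma cmod_minus_1: "(cmod (z - 1))\<^sup>2 = (cmod z)\<^sup>2 - 2 * Re z + 1"
  unfolding cmod_power2 by (simp add: power2_eq_square algebra_simps)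

lemma cmod_one_minus_cis: "(cmod (1 - of_real a * cis t))\<^sup>2 = 1 + a\<^sup>2 - 2 * a * cos t"
proof -
  have "(cmod (1 - of_real a * cis t))\<^sup>2 = (1 - a * cos t)\<^sup>2 + (a * sin t)\<^sup>2"
    by (simp add: cmod_power2)
  then show ?thesis using sin_cos_squared_add[of t] by algebra
qed

lemma islimpt_image:
  fixes f :: "real \<Rightarrow> complex"
  assumes "continuous_on {0..t} f" "f ` {0..t} \<subseteq> S" "f 0 \<noteq> f t" "t \<ge> 0"
  shows "f t islimpt S"
proof (rule islimpt_subset[OF connected_imp_perfect assms(2)])
  show "connected (f ` {0..t})" using assms(1) by (rule connected_continuous_image) simp
  show "f t \<in> f ` {0..t}" using assms(4) by auto
  show "f ` {0..t} \<noteq> {x}" for x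
  proof
    assume "f ` {0..t} = {x}"
    moreover have "f 0 \<in> f ` {0..t}" "f t \<in> f ` {0..t}" using assms(4) by auto
    ultimately show False using assms(3) by simp
  qed
qed

section \<open>Tangents at the corner and the value of \<zeta>\<close>

context lens
begin

lemma Re_u: "2 * Re u = r\<^sup>2 + 1 - s\<^sup>2"
proof -
  have "(cmod (u - 1))\<^sup>2 = (cmod u)\<^sup>2 - 2 * Re u + 1"
    unfolding cmod_power2 by (simp add: power2_eq_square algebra_simps)
  then show ?thesis by (simp add: cmod_u)
qed

lemma sphere_inter: "sphere 0 r \<inter> sphere 1 s = {u, cnj u}"
proof (intro set_eqI iffI)
  fix z :: complex assume "z \<in> sphere 0 r \<inter> sphere 1 s"
  then have z: "cmod z = r" "cmod (z - 1) = s" by (auto simp: dist_norm norm_minus_commute)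
  then have "2 * Re z = 2 * Re u" using cmod_minus_1[of z] Re_u by simp
  moreover have "(cmod z)\<^sup>2 = (cmod u)\<^sup>2" using z cmod_u by simp
  ultimately have "Re z = Re u" "(Im z)\<^sup>2 = (Im u)\<^sup>2" by (auto simp: cmod_power2)
  then show "z \<in> {u, cnj u}" by (auto simp: complex_eq_iff power2_eq_iff)
next
  fix z assume "z \<in> {u, cnj u}"
  moreover have "cmod (cnj u) = r" "cmod (cnj u - 1) = s"
    using cmod_u complex_mod_cnj[of "u - 1"] by simp_all
  ultimately show "z \<in> sphere 0 r \<inter> sphere 1 s"
    using cmod_u by (auto simp: dist_norm norm_minus_commute)
qed

text \<open>Each arc is followed from the real axis, from \<open>r\<close> or \<open>1 - s\<close>,
  up to \<open>u\<close>. Cosine decreases on \<open>[0, pi]\<close>, so the distance to the other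
  centre grows and reaches the other radius only at \<open>u\<close>.\<close>

lemma u_islimpt: "u islimpt (sphere 0 r \<inter> cball 1 s)" "u islimpt (cball 0 r \<inter> sphere 1 s)"
proof -
  have dist1: "dist 1 z \<le> s \<longleftrightarrow> (cmod (1 - z))\<^sup>2 \<le> s\<^sup>2" for z
    using s by (simp add: dist_norm abs_le_square_iff[symmetric])
  have ss: "s\<^sup>2 = 1 + r\<^sup>2 - 2 * r * cos \<theta>"
    unfolding cmod_one_minus_cis[symmetric] using cmod_u(2) by (simp add: norm_minus_commute u_r)
  have rr: "r\<^sup>2 = 1 + s\<^sup>2 - 2 * s * cos \<phi>"
    using cmod_u(1) cmod_one_minus_cis[of s "- \<phi>"] by (simp add: u_s)
  have nr: "u \<noteq> of_real r" "u \<noteq> 1 - of_real s" using Im_u by auto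
  have "(\<lambda>t. of_real r * cis t) \<theta> islimpt (sphere 0 r \<inter> cball 1 s)"
  proof (rule islimpt_image[where f = "\<lambda>t. of_real r * cis t"])
    show "(\<lambda>t. of_real r * cis t) ` {0..\<theta>} \<subseteq> sphere 0 r \<inter> cball 1 s"
    proof safe
      fix t assume t: "t \<in> {0..\<theta>}"
      then have "cos \<theta> \<le> cos t" using angles by (intro cos_monotone_0_pi_le) auto
      then show "of_real r * cis t \<in> cball 1 s"
        using r by (simp add: dist1 ss cmod_one_minus_cis)
    qed (use r in \<open>auto simp: norm_mult\<close>)
  qed (use angles nr u_r in \<open>auto intro!: continuous_intros simp: cis_conv_exp\<close>)
  then show "u islimpt (sphere 0 r \<inter> cball 1 s)" by (simp add: u_r)
  have "(\<lambda>t. 1 - of_real s * cis (- t)) \<phi> islimpt (cball 0 r \<inter> sphere 1 s)"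
  proof (rule islimpt_image[where f = "\<lambda>t. 1 - of_real s * cis (- t)"])
    show "(\<lambda>t. 1 - of_real s * cis (- t)) ` {0..\<phi>} \<subseteq> cball 0 r \<inter> sphere 1 s"
    proof safe
      fix t assume t: "t \<in> {0..\<phi>}"
      then have "cos \<phi> \<le> cos t" using angles by (intro cos_monotone_0_pi_le) auto
      then have "(cmod (1 - of_real s * cis (- t)))\<^sup>2 \<le> r\<^sup>2"
        using s by (simp add: rr cmod_one_minus_cis)
      then show "1 - of_real s * cis (- t) \<in> cball 0 r"
        using r by (simp add: abs_le_square_iff[symmetric])
    qed (use s in \<open>auto simp: dist_norm norm_mult\<close>)
  qed (use angles nr u_s in \<open>auto intro!: continuous_intros simp: cis_conv_exp\<close>)
  then show "u islimpt (cball 0 r \<inter> sphere 1 s)" by (simp add: u_s)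
qed

lemma eventually_Im_pos: "\<forall>\<^sub>F z in at u within S. Im z > 0 \<and> z \<noteq> u \<and> z \<in> S"
proof -
  have "(Im \<longlongrightarrow> Im u) (at u within S)" by (intro tendsto_intros)
  then have "\<forall>\<^sub>F z in at u within S. Im z > 0" using Im_u by (rule order_tendstoD)
  moreover have "\<forall>\<^sub>F z in at u within S. z \<noteq> u \<and> z \<in> S"
    by (simp add: eventually_at_filter)
  ultimately show ?thesis by (rule eventually_elim2) auto
qed

text \<open>Inside the other disk the real part is at least \<open>Re u\<close> on the circle about
  \<open>0\<close> and at most \<open>Re u\<close> on the circle about \<open>1\<close>. Hence the
  first arc leaves \<open>u\<close> clockwise, the second counterclockwise.\<close>

lemma half_tangents:
  "half_tangent (sphere 0 r \<inter> cball 1 s) u = - \<i> * cis \<theta>"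
  "half_tangent (cball 0 r \<inter> sphere 1 s) u = \<i> * cis (pi - \<phi>)"
proof -
  have "half_tangent (sphere 0 r \<inter> cball 1 s) u = of_real (- 1) * \<i> * sgn (u - 0)"
  proof (rule half_tangent_circle[where R = r])
    show "\<forall>\<^sub>F z in at u within sphere 0 r \<inter> cball 1 s. - 1 * Im ((z - 0) * cnj (u - 0)) > 0"
      using eventually_Im_pos
    proof eventually_elim
      case (elim z)
      then have "cmod z = r" "cmod (z - 1) \<le> s" by (auto simp: dist_norm norm_minus_commute)
      moreover from this(2) have "(cmod (z - 1))\<^sup>2 \<le> s\<^sup>2" by (intro power_mono) auto
      ultimately have "Re u \<le> Re z" using cmod_minus_1[of z] Re_u by simp
      then have "Im (u * cnj z) > 0"
        using elim Im_u \<open>cmod z = r\<close> cmod_u(1) by (intro Im_mult_cnj_pos) auto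
      then show ?case by (simp add: algebra_simps)
    qed
  qed (use u_islimpt r cmod_u in auto)
  also have "sgn (u - 0) = cis \<theta>"
    using r unfolding u_r by (simp add: Real_Vector_Spaces.sgn_mult sgn_of_real)
  finally show "half_tangent (sphere 0 r \<inter> cball 1 s) u = - \<i> * cis \<theta>" by simp
  have "half_tangent (cball 0 r \<inter> sphere 1 s) u = of_real 1 * \<i> * sgn (u - 1)"
  proof (rule half_tangent_circle[where R = s])
    show "\<forall>\<^sub>F z in at u within cball 0 r \<inter> sphere 1 s. 1 * Im ((z - 1) * cnj (u - 1)) > 0"
      using eventually_Im_pos
    proof eventually_elim
      case (elim z)
      then have "cmod z \<le> r" "cmod (z - 1) = s" by (auto simp: dist_norm norm_minus_commute)
      moreover from this(1) have "(cmod z)\<^sup>2 \<le> r\<^sup>2" by (intro power_mono) auto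
      ultimately have "Re z \<le> Re u" using cmod_minus_1[of z] Re_u by simp
      then have "Im ((z - 1) * cnj (u - 1)) > 0"
        using elim Im_u \<open>cmod (z - 1) = s\<close> cmod_u(2) by (intro Im_mult_cnj_pos) auto
      then show ?case by simp
    qed
  qed (use u_islimpt s cmod_u in \<open>auto simp: dist_norm norm_minus_commute\<close>)
  also have "sgn (u - 1) = cis (pi - \<phi>)"
    using s unfolding u_minus_1 by (simp add: Real_Vector_Spaces.sgn_mult sgn_of_real)
  finally show "half_tangent (cball 0 r \<inter> sphere 1 s) u = \<i> * cis (pi - \<phi>)" by simp
qed

lemma boundary_angle_eq: "boundary_angle (cball 0 r) (cball 1 s) u = \<theta> + \<phi>"
proof -
  have "inner (\<i> * cis \<theta>) (\<i> * cis (pi - \<phi>)) = - cos (\<theta> + \<phi>)"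
    by (simp add: inner_complex_def cos_add)
  then show ?thesis
    using angles by (simp add: boundary_angle_def vector_angle_def half_tangents norm_mult arccos_cos)
qed

text \<open>The base is \<open>cis (pi - \<theta>)\<close> with \<open>pi - \<theta>\<close>
  strictly between \<open>0\<close> and \<open>pi\<close>, so just one logarithm has imaginary part
  in \<open>[0, 2 * pi]\<close>; the root follows from
  \<open>q * (pi - \<beta>) = pi - \<theta>\<close>.\<close>

lemma branch_power_iff:
  "branch_power ((cnj u - of_real r) / (u - of_real r)) (1 / q) \<zeta> \<longleftrightarrow> \<zeta> = cis (pi - \<beta>)"
proof -
  have "u \<noteq> of_real r" using Im_u by auto
  moreover have "cis (pi - \<theta>) * (u - of_real r) = cnj u - of_real r"
    by (simp add: u_r complex_eq_iff algebra_simps) (metis sin_cos_squared_add3 distrib_left mult.right_neutral)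
  ultimately have w: "(cnj u - of_real r) / (u - of_real r) = cis (pi - \<theta>)"
    by (simp add: divide_eq_eq)
  have \<zeta>: "exp (of_real (1 / q) * (\<i> * of_real (pi - \<theta>))) = cis (pi - \<beta>)"
  proof -
    have "1 / q * (pi - \<theta>) = pi - \<beta>" using q unfolding q_\<beta>(2)[symmetric] by simp
    moreover have "of_real (1 / q) * (\<i> * of_real (pi - \<theta>)) = \<i> * of_real (1 / q * (pi - \<theta>))"
      by (simp only: of_real_mult mult_ac)
    ultimately show ?thesis by (simp only: cis_conv_exp)
  qed
  have "L = \<i> * of_real (pi - \<theta>)" if L: "exp L = cis (pi - \<theta>)" "0 \<le> Im L" "Im L \<le> 2 * pi" for L
  proof -
    obtain n :: int where n: "L = \<i> * of_real (pi - \<theta>) + (of_int (2 * n) * pi) * \<i>"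
      using L(1) unfolding cis_conv_exp exp_eq by blast
    then have "Im L = pi - \<theta> + 2 * (pi * of_int n)" by simp
    then have "pi * of_int n > pi * of_int (- 1)" "pi * of_int n < pi * of_int 1"
      using L(2,3) angles unfolding of_int_1 of_int_minus mult_1_right mult_minus_right by linarith+
    then have "n = 0" using pi_gt_zero by (simp only: mult_less_cancel_left_pos of_int_less_iff)
    with n show ?thesis by simp
  qed
  moreover have "exp (\<i> * of_real (pi - \<theta>)) = cis (pi - \<theta>)" by (simp only: cis_conv_exp)
  moreover have "Im (\<i> * of_real (pi - \<theta>)) = pi - \<theta>" by simp
  ultimately show ?thesis
    unfolding branch_power_def w using angles \<zeta>
    by (smt (verit) pi_gt_zero)
qed

lemma tendsto_nth_diameter_lens:
  "(\<lambda>n. nth_diameter n (cball 0 r \<inter> cball 1 s)) \<longlonglongrightarrow> 1 / (2 * sin (pi - \<beta>)) * (1 / q) * cmod (cnj u - u)"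
  unfolding cmod_\<psi>_0[symmetric]
proof (rule tendsto_nth_diameter[OF _ _ \<psi>_holomorphic \<psi>_continuous \<psi>_inside \<psi>_boundary])
  show "compact (cball 0 r \<inter> cball (1::complex) s)" by (intro compact_Int_closed) auto
  show "cball 0 r \<inter> cball (1::complex) s \<noteq> {}" using \<psi>_boundary[of 1] by auto
qed auto

end

section \<open>Scaling and degenerate positions of two disks\<close>

lemma cball_scale_image:
  fixes \<xi> :: complex
  assumes "\<xi> \<noteq> 0"
  shows "(\<lambda>z. \<xi> * z) ` cball w t = cball (\<xi> * w) (cmod \<xi> * t)"
proof (intro set_eqI iffI)
  fix z assume z: "z \<in> cball (\<xi> * w) (cmod \<xi> * t)"
  have "\<xi> * w - z = \<xi> * (w - z / \<xi>)" using assms by (simp add: right_diff_distrib)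
  then have "cmod \<xi> * cmod (w - z / \<xi>) \<le> cmod \<xi> * t"
    using z by (simp add: dist_norm norm_mult)
  then have "z / \<xi> \<in> cball w t" using assms by (simp add: dist_norm)
  then show "z \<in> (\<lambda>z. \<xi> * z) ` cball w t"
    using assms by (intro image_eqI[where x = "z / \<xi>"]) auto
qed (auto simp: dist_norm norm_mult mult_left_mono simp flip: right_diff_distrib)

lemma cball_Int_cball_scale:
  fixes \<xi> :: complex
  assumes "\<xi> \<noteq> 0"
  shows "(\<lambda>z. \<xi> * z) ` (cball w t \<inter> cball w' t') =
    cball (\<xi> * w) (cmod \<xi> * t) \<inter> cball (\<xi> * w') (cmod \<xi> * t')"
  using assms by (subst image_Int) (auto simp: inj_on_def cball_scale_image)

lemma cball_0_1_subset:
  "s \<ge> 1 + r \<Longrightarrow> cball 0 r \<subseteq> cball (1::complex) s"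
  "r \<ge> 1 + s \<Longrightarrow> cball (1::complex) s \<subseteq> cball 0 r"
proof -
  have "cmod z \<le> 1 + cmod (1 - z)" "cmod (1 - z) \<le> 1 + cmod z" for z :: complex
    using norm_triangle_ineq4[of 1 "1 - z"] norm_triangle_ineq4[of 1 z] by simp_all
  then show "s \<ge> 1 + r \<Longrightarrow> cball 0 r \<subseteq> cball (1::complex) s"
    "r \<ge> 1 + s \<Longrightarrow> cball (1::complex) s \<subseteq> cball 0 r"
    unfolding subset_iff mem_cball dist_norm diff_0 norm_minus_cancel by (metis add_left_mono order_trans)+
qed

lemma cball_tangent:
  assumes "r + s = 1" "0 \<le> r" "0 \<le> s"
  shows "cball 0 r \<inter> cball 1 s = {of_real r :: complex}"
proof (intro set_eqI iffI)
  fix z :: complex assume "z \<in> cball 0 r \<inter> cball 1 s"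
  then have z: "cmod z \<le> r" "cmod (1 - z) \<le> s" by (auto simp: dist_norm)
  then have "Re z \<le> r" "1 - Re z \<le> s"
    using complex_Re_le_cmod[of z] complex_Re_le_cmod[of "1 - z"] by auto
  then have Re: "Re z = r" using assms by linarith
  moreover have "(cmod z)\<^sup>2 \<le> r\<^sup>2" using z by (intro power_mono) auto
  ultimately have "Im z = 0" by (simp add: cmod_power2)
  with Re show "z \<in> {of_real r}" by (simp add: complex_eq_iff)
next
  fix z :: complex assume "z \<in> {of_real r}"
  moreover have "cmod (1 - of_real r) = s"
    using assms by (metis abs_of_nonneg add_diff_cancel_left' norm_of_real of_real_1 of_real_diff)
  ultimately show "z \<in> cball 0 r \<inter> cball 1 s" using assms by (simp add: dist_norm)
qed

lemma lens_exists:
  assumes "r + s > 1" "r < 1 + s" "s < 1 + r"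
  obtains \<theta> \<phi> u where "lens r s \<theta> \<phi> u"
proof -
  have rs: "r > 0" "s > 0" using assms by linarith+
  \<comment> \<open>Subtracting the equations of the two circles gives the real part of their common
    points.\<close>
  define a where "a = (r\<^sup>2 + 1 - s\<^sup>2) / 2"
  have "(r - 1)\<^sup>2 < s\<^sup>2" 
    using assms rs power_strict_mono[of "\<bar>r - 1\<bar>" s 2] by simp
  then have "a < r" by (simp add: a_def power2_eq_square algebra_simps)
  have "s\<^sup>2 < (r + 1)\<^sup>2" using assms rs by (intro power_strict_mono) auto
  then have "- r < a" by (simp add: a_def power2_eq_square algebra_simps)
  then have "a\<^sup>2 < r\<^sup>2" 
    using \<open>a < r\<close> power_strict_mono[of "\<bar>a\<bar>" r 2] by simp
  define b where "b = sqrt (r\<^sup>2 - a\<^sup>2)"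
  have b: "b > 0" "b\<^sup>2 = r\<^sup>2 - a\<^sup>2" using \<open>a\<^sup>2 < r\<^sup>2\<close> by (auto simp: b_def)
  define u where "u = Complex a b"
  have u: "cmod u = r" using b rs by (simp add: u_def cmod_def)
  have "(1 - a)\<^sup>2 + b\<^sup>2 = s\<^sup>2" using b by (simp add: a_def power2_eq_square algebra_simps)
  then have u': "cmod (1 - cnj u) = s" using rs by (simp add: u_def cmod_def)
  define \<theta> where "\<theta> = Arg u"
  define \<phi> where "\<phi> = Arg (1 - cnj u)"
  have range: "0 < \<theta>" "\<theta> < pi" "0 < \<phi>" "\<phi> < pi"
    using Arg_lt_pi[of u] Arg_lt_pi[of "1 - cnj u"] b by (auto simp: \<theta>_def \<phi>_def u_def)
  have ur: "u = of_real r * cis \<theta>"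
    using rcis_cmod_Arg[of u] by (simp add: u \<theta>_def rcis_def)
  have us: "1 - cnj u = of_real s * cis \<phi>"
    using rcis_cmod_Arg[of "1 - cnj u"] by (simp add: u' \<phi>_def rcis_def)
  \<comment> \<open>The product has argument \<open>\<theta> + \<phi>\<close>, and its positive
    imaginary part rules out \<open>\<theta> + \<phi> \<ge> pi\<close>.\<close>
  have "u * (1 - cnj u) = of_real (r * s) * cis (\<theta> + \<phi>)"
    by (simp add: us) (simp add: ur cis_mult[symmetric])
  moreover have "Im (u * (1 - cnj u)) = b"
    by (simp add: u_def algebra_simps)
  ultimately have "r * s * sin (\<theta> + \<phi>) = b" by (metis Im_complex_of_real Re_complex_of_real add.commute cis.sel(2) mult_zero_left add_0 times_complex.sel(2))
  then have "sin (\<theta> + \<phi>) > 0" using b rs by (metis zero_less_mult_iff mult_pos_pos less_asym)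
  then have "\<theta> + \<phi> < pi" using range sin_le_zero[of "\<theta> + \<phi>"] by (cases "\<theta> + \<phi> < pi") auto
  moreover have "u = 1 - of_real s * cis (- \<phi>)"
    using arg_cong[OF us, of cnj] by (simp add: cis_cnj algebra_simps)
  ultimately have "lens r s \<theta> \<phi> u"
    using rs range ur by unfold_locales auto
  then show thesis by (rule that)
qed

section \<open>Intersections of two disks\<close>

lemma two_disks_cases:
  assumes "0 \<le> r" "0 \<le> s" "cball 0 r \<inter> cball (1::complex) s \<noteq> {}"
  obtains "r + s = 1" | "r \<ge> 1 + s" | "s \<ge> 1 + r" | \<theta> \<phi> u where "lens r s \<theta> \<phi> u"
proof -
  obtain z :: complex where "cmod z \<le> r" "cmod (1 - z) \<le> s"
    using assms(3) by (auto simp: dist_norm)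
  then have "r + s \<ge> 1" using norm_triangle_ineq[of z "1 - z"] by simp
  then consider "r + s = 1" | "r \<ge> 1 + s" | "s \<ge> 1 + r" | "r + s > 1" "r < 1 + s" "s < 1 + r"
    by linarith
  then show thesis
  proof cases
    case 4
    then show thesis using lens_exists that(4) by blast
  qed (rule that, assumption)+
qed

lemma convergent_nth_diameter_two_disks:
  assumes rs: "0 \<le> r" "0 \<le> s" "cball 0 r \<inter> cball (1::complex) s \<noteq> {}"
  shows "convergent (\<lambda>n. nth_diameter n (cball 0 r \<inter> cball 1 s))"
  using rs
proof (cases rule: two_disks_cases)
  case 1
  then show ?thesis
    using tendsto_nth_diameter_cball[of 0 "of_real r"] rs by (auto simp: cball_tangent[OF _ rs(1,2)] convergent_def)
next
  case 2
  then have "cball 0 r \<inter> cball (1::complex) s = cball 1 s" using cball_0_1_subset by blast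
  then show ?thesis using tendsto_nth_diameter_cball[OF rs(2)] by (auto simp: convergent_def)
next
  case 3
  then have "cball 0 r \<inter> cball (1::complex) s = cball 0 r" using cball_0_1_subset by blast
  then show ?thesis using tendsto_nth_diameter_cball[OF rs(1)] by (auto simp: convergent_def)
next
  case (4 \<theta> \<phi> u)
  then show ?thesis using lens.tendsto_nth_diameter_lens unfolding convergent_def by blast
qed

lemma two_disks_as_scaled:
  fixes c :: complex
  assumes "0 \<le> a" "0 \<le> b"
  shows "\<exists>\<xi> r s. \<xi> \<noteq> 0 \<and> 0 \<le> r \<and> 0 \<le> s \<and>
    cball 0 a \<inter> cball c b = (\<lambda>z. \<xi> * z) ` (cball 0 r \<inter> cball 1 s)"
proof (cases "c = 0")
  case True
  \<comment> \<open>For concentric disks \<open>\<xi> = 1\<close> serves, with the disk about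
    \<open>1\<close> just large enough to contain the smaller of the two.\<close>
  have "cball 0 a \<inter> cball c b = cball 0 (min a b)" using True by (simp add: set_eq_iff)
  also have "\<dots> = cball 0 (min a b) \<inter> cball 1 (1 + min a b)"
    using cball_0_1_subset(1)[of "min a b" "1 + min a b"] by (intro Int_absorb2[symmetric]) simp
  also have "\<dots> = (\<lambda>z. 1 * z) ` (cball 0 (min a b) \<inter> cball 1 (1 + min a b))"
    by (simp only: mult_1 image_ident)
  finally have "cball 0 a \<inter> cball c b = \<dots>" .
  moreover have "(1::complex) \<noteq> 0" "0 \<le> min a b" "0 \<le> 1 + min a b" using assms by auto
  ultimately show ?thesis by blast
next
  case False
  then have "cball 0 a \<inter> cball c b = (\<lambda>z. c * z) ` (cball 0 (a / cmod c) \<inter> cball 1 (b / cmod c))"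
    by (simp add: cball_Int_cball_scale)
  moreover have "0 \<le> a / cmod c" "0 \<le> b / cmod c" using assms by auto
  ultimately show ?thesis using False by blast
qed

lemma lens_capacity:
  assumes "lens r s \<theta> \<phi> u"
  shows "0 < Im u \<and> frontier (cball 0 r) \<inter> frontier (cball 1 s) = {u, cnj u} \<and>
    (let \<alpha> = boundary_angle (cball 0 r) (cball 1 s) u;
         is_zeta = (\<lambda>\<zeta>. 0 < Im \<zeta> \<and>
           branch_power ((cnj u - of_real r) / (u - of_real r)) (pi / (2 * pi - \<alpha>)) \<zeta>)
     in 0 < \<alpha> \<and> \<alpha> < pi \<and> (\<exists>!\<zeta>. is_zeta \<zeta>) \<and>
        (\<forall>\<zeta>. is_zeta \<zeta> \<longrightarrow>
           transfinite_diameter (cball 0 r \<inter> cball 1 s) =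
             1 / (2 * Im \<zeta>) * (pi / (2 * pi - \<alpha>)) * cmod (cnj u - u)))"
proof -
  interpret lens r s \<theta> \<phi> u by (rule assms)
  have p: "pi / (2 * pi - (\<theta> + \<phi>)) = 1 / q" by (simp add: q_def diff_diff_add)
  have Im: "Im (cis (pi - \<beta>)) > 0" using \<beta> by (simp add: sin_gt_zero)
  have ne: "cball 0 r \<inter> cball (1::complex) s \<noteq> {}" using \<psi>_boundary[of 1] by auto
  have "transfinite_diameter (cball 0 r \<inter> cball 1 s) =
      1 / (2 * Im (cis (pi - \<beta>))) * (1 / q) * cmod (cnj u - u)"
    using transfinite_diameter_eqI[OF tendsto_nth_diameter_lens ne] by simp
  then show ?thesis
    unfolding Let_def boundary_angle_eq p branch_power_iff
    using Im Im_u sphere_inter angles by auto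
qed

theorem theorem3p5:
  fixes v :: "('k::field_char_0 \<Rightarrow> real) set"
    and \<sigma> :: "'k \<Rightarrow> complex"
    and E :: "complex set" and c :: complex and a b :: real
  assumes "number_field TYPE('k)"
    and "archimedean_place v"
    and "identifies_with_complex v \<sigma>"
    and "0 \<le> a" and "0 \<le> b"
    and "E = cball 0 a \<inter> cball c b"
  shows
    "(\<exists>\<xi> r s. \<xi> \<noteq> 0 \<and> 0 \<le> r \<and> 0 \<le> s \<and> E = (\<lambda>z. \<xi> * z) ` (cball 0 r \<inter> cball 1 s)) \<and>
     (\<forall>\<xi> r s V. \<xi> \<noteq> 0 \<longrightarrow> 0 \<le> r \<longrightarrow> 0 \<le> s \<longrightarrow> V = cball 0 r \<inter> cball 1 s \<longrightarrow>
        E = (\<lambda>z. \<xi> * z) ` V \<longrightarrow>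
        local_capacity \<sigma> E = (cmod \<xi> * transfinite_diameter V) ^ local_degree \<sigma> \<and>
        (V = {} \<or> r + s = 1 \<longrightarrow> transfinite_diameter V = 0) \<and>
        (r \<ge> 1 + s \<longrightarrow> V = cball 1 s \<and> transfinite_diameter V = s) \<and>
        (s \<ge> 1 + r \<longrightarrow> V = cball 0 r \<and> transfinite_diameter V = r) \<and>
        (\<not> (V = {} \<or> r + s = 1) \<and> \<not> r \<ge> 1 + s \<and> \<not> s \<ge> 1 + r \<longrightarrow>
          (\<exists>u. 0 < Im u \<and> frontier (cball 0 r) \<inter> frontier (cball 1 s) = {u, cnj u} \<and>
             (let \<alpha> = boundary_angle (cball 0 r) (cball 1 s) u;
                  is_zeta = (\<lambda>\<zeta>. 0 < Im \<zeta> \<and>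
                    branch_power ((cnj u - of_real r) / (u - of_real r)) (pi / (2 * pi - \<alpha>)) \<zeta>)
              in 0 < \<alpha> \<and> \<alpha> < pi \<and>
                 (\<exists>!\<zeta>. is_zeta \<zeta>) \<and>
                 (\<forall>\<zeta>. is_zeta \<zeta> \<longrightarrow>
                    transfinite_diameter V =
                      1 / (2 * Im \<zeta>) * (pi / (2 * pi - \<alpha>)) * cmod (cnj u - u))))))"
proof (intro conjI allI impI, goal_cases)
  case 1
  then show ?case unfolding assms(6) by (rule two_disks_as_scaled[OF assms(4,5)])
next
  case (2 \<xi> r s V)
  have "transfinite_diameter E = cmod \<xi> * transfinite_diameter V"
    unfolding 2(5)
  proof (rule transfinite_diameter_scale)
    show "bounded V" unfolding 2(4) by (simp add: bounded_Int)
    show "V \<noteq> {} \<Longrightarrow> convergent (\<lambda>n. nth_diameter n V)"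
      unfolding 2(4) by (rule convergent_nth_diameter_two_disks[OF 2(2,3)])
  qed (rule 2(1))
  then show ?case by (simp add: local_capacity_def)
next
  case (3 \<xi> r s V)
  show ?case
  proof (cases "V = {}")
    case True
    then show ?thesis by (simp add: transfinite_diameter_def)
  next
    case False
    then have "V = cball (of_real r) 0" using 3 by (simp add: cball_tangent)
    then show ?thesis using transfinite_diameter_eqI[OF tendsto_nth_diameter_cball[of 0 "of_real r"]] by simp
  qed
next
  case (4 \<xi> r s V)
  then show ?case using cball_0_1_subset(2) by blast
next
  case (5 \<xi> r s V)
  then have "V = cball 1 s" using cball_0_1_subset(2) by blast
  then show ?case using transfinite_diameter_eqI[OF tendsto_nth_diameter_cball[of s 1]] 5(3) by simp
next
  case (6 \<xi> r s V)
  then show ?case using cball_0_1_subset(1) by blast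
next
  case (7 \<xi> r s V)
  then have "V = cball 0 r" using cball_0_1_subset(1) by blast
  then show ?case using transfinite_diameter_eqI[OF tendsto_nth_diameter_cball[of r 0]] 7(2) by simp
next
  case (8 \<xi> r s V)
  from 8(4,6) have "cball 0 r \<inter> cball (1::complex) s \<noteq> {}" by simp
  from 8(2,3) this show ?case
  proof (cases rule: two_disks_cases)
    case (4 \<theta> \<phi> u)
    show ?thesis unfolding 8(4) by (rule exI[of _ u], rule lens_capacity[OF 4])
  qed (use 8(6) in simp_all)
qed

end
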